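(* Let $\nu_0=n-\nu_1-\cdots-\nu_p$. Problem 1C (stated in the context) is solvable if and only if $$\dim\Big(\mathcal V^\star_g+\sum_{i\in P}\mathcal R^\star_i\Big)\ge\sum_{i\in P}\nu_i+\nu_0$$ and $$\dim\Big(\sum_{i\in P}\mathcal R^\star_i\Big)\ge\sum_{i\in P}\nu_i$$ for all $P$ in the power set $2^I$, where $I=\{1,2,\ldots,p\}$.
   Context: System: $\Sigma=(A,B,C,D)$ is $\mathcal D x=Ax+Bu$, $y=Cx+Du$, $x(t)\in\mathbb R^n$, $u(t)\in\mathbb R^m$, $y(t)\in\mathbb R^p$, real matrices; $\mathcal D x=\dot x$ (continuous time) or $x(t+1)$ (discrete time). $\mathbb C_g$ is the open left half-plane (continuous) or open unit disc (discrete), $\mathbb R_g=\mathbb C_g\cap\mathbb R$. $\mathcal Z$ is the set of invariant zeros of $\Sigma$: those $\lambda\in\mathbb C$ at which the rank of $\begin{bmatrix}A-\lambda I&B\\C&D\end{bmatrix}$ is below its normal rank; minimum-phase zeros are those in $\mathbb C_g$. Standing assumptions: $\Sigma$ is right invertible (that matrix pencil has full row rank for all but finitely many $\lambda$), stabilizable, with no invariant zero at $0$ (continuous) or $1$ (discrete); algebraic and geometric multiplicities of each minimum-phase invariant zero coincide; no Jordan chains are allowed in the closed loop ($A+BF$ diagonalizable); in this part all closed-loop eigenvalues considered and all minimum-phase invariant zeros are real. Control: $u=Fx+Gr$, $F$ real with $\sigma(A+BF)\subset\mathbb C_g$, $G$ a right inverse of the closed-loop static gain. For constant $r$, $\epsilon=y-r$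 satisfies $\mathcal D\xi=(A+BF)\xi$, $\epsilon=(C+DF)\xi$. State-to-output decoupling: for any initial condition, $\epsilon_i(t)=\sum_{j=1}^{\nu_i}\beta_{i,j}e^{\lambda_{i,j}t}$ (resp. $\sum_j\beta_{i,j}\lambda_{i,j}^t$), $i=1,\ldots,p$, where the $\lambda_{i,j}$ are the observable closed-loop eigenvalues and the coefficients $\beta_{i,j}$ can be made arbitrary by choice of $\xi(0)$. That is, $A+BF$ has a basis of eigenvectors $v_{0,1},\ldots,v_{0,\nu_0},v_{1,1},\ldots,v_{p,\nu_p}$ with eigenvalues $\lambda_{i,j}$ such that $(C+DF)v_{0,j}=0$ and $(C+DF)v_{i,j}$ is a nonzero multiple of the $i$-th canonical vector $e_i\in\mathbb R^p$ for $i\ge1$; the $\lambda_{i,j}$ ($1\le j\le\nu_i$) are the eigenvalues observable from $\epsilon_i$ and the $\lambda_{0,j}$ the unobservable ones (all counted with multiplicity). Problem 1C: given nonnegative integers $\nu_1,\ldots,\nu_p$ with $\nu_0=n-\sum_i\nu_i\ge0$, find $F,G$ such that: (1) $y(t)\to\bar r$ for every constant reference $r(t)=\bar r$; (2) state-to-output decoupling is achieved; (3) from each $\epsilon_i$ exactly $\nu_i$ eigenvalues are observable and they are not invariant zeros; neither the observable nor the unobservable eigenvalues are assigned a priori (the unobservable ones may be invariant zeros). Solvable means such $F,G$ exist. Subspaces: $\mathcal V^\star_g$ is the largest stabilizability output-nulling subspace of $\Sigma$: the largest subspace $\mathcal V\subseteq\mathbb R^n$ for which there is a real $F$ with $(A+BF)\mathcal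 V\subseteq\mathcal V\subseteq\ker(C+DF)$ and $\sigma(A+BF|\mathcal V)\subset\mathbb C_g$. $\mathcal R^\star_i$ is the supremal output-nulling reachability subspace of the quadruple $(A,B,C_{(i)},D_{(i)})$, where $C_{(i)},D_{(i)}$ are $C,D$ with the $i$-th row removed (i.e. the reachability subspace on the largest output-nulling subspace $\mathcal V^\star_i$ of that quadruple). *)

theory Defs
  imports
    "HOL-Analysis.Analysis"
    "HOL-Computational_Algebra.Computational_Algebra"
    "HOL-Computational_Algebra.Field_as_Ring"
    "HOL-Library.Set_Algebras"
begin

text \<open>
  A system is given by real matrices \<open>A\<close>, \<open>B\<close>, \<open>C\<close>, \<open>D\<close> whose sizes are the index types:
  \<open>'n\<close> for the state, \<open>'m\<close> for the input and \<open>'p\<close> for the output.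
\<close>

datatype time_domain = Continuous | Discrete

fun stability_region :: "time_domain \<Rightarrow> complex set" where
  "stability_region Continuous = {z. Re z < 0}"
| "stability_region Discrete = {z. cmod z < 1}"


subsection \<open>Spectra\<close>

definition complex_matrix :: "real^'c^'r \<Rightarrow> complex^'c^'r" where
  "complex_matrix M = (\<chi> i j. complex_of_real (M $ i $ j))"

text \<open>
  For an \<open>M\<close>-invariant real subspace \<open>V\<close> this is the (complex) spectrum of the restriction of
  \<open>M\<close> to \<open>V\<close>: a complex vector lies in the complexification of \<open>V\<close> iff its real and imaginary
  parts lie in \<open>V\<close>.
\<close>

definition spectrum_on :: "real^'n^'n \<Rightarrow> (real^'n) set \<Rightarrow> complex set" where
  "spectrum_on M V = {z. \<exists>w :: complex^'n. w \<noteq> 0 \<and> (\<chi> k. Re (w $ k)) \<in> V \<and> (\<chi> k. Im (w $ k)) \<in> V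
     \<and> complex_matrix M *v w = z *s w}"

abbreviation spectrum :: "real^'n^'n \<Rightarrow> complex set" where
  "spectrum M \<equiv> spectrum_on M UNIV"

definition stabilizable :: "time_domain \<Rightarrow> real^'n^'n \<Rightarrow> real^'m^'n \<Rightarrow> bool" where
  "stabilizable T A B \<longleftrightarrow> (\<exists>F :: real^'n^'m. spectrum (A + B ** F) \<subseteq> stability_region T)"


subsection \<open>The system matrix pencil and invariant zeros\<close>

text \<open>
  The block matrix with rows \<open>(A - s I, B)\<close> and \<open>(C, D)\<close> over a ring into which the reals are
  mapped by \<open>h\<close>.  It is used over the complex numbers, with \<open>s\<close> a number, and over the complex
  polynomials, with \<open>s\<close> the indeterminate.
\<close>

definition system_matrix ::
  "(real \<Rightarrow> 'a::comm_ring_1) \<Rightarrow> real^'n^'n \<Rightarrow> real^'m^'n \<Rightarrow> real^'n^'p \<Rightarrow> real^'m^'p \<Rightarrow> 'a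
     \<Rightarrow> 'a^('n + 'm)^('n + 'p)" where
  "system_matrix h A B C D s = (\<chi> r c.
     case r of
       Inl i \<Rightarrow> (case c of Inl j \<Rightarrow> h (A $ i $ j) - (if i = j then s else 0) | Inr j \<Rightarrow> h (B $ i $ j))
     | Inr i \<Rightarrow> (case c of Inl j \<Rightarrow> h (C $ i $ j) | Inr j \<Rightarrow> h (D $ i $ j)))"

definition pencil ::
  "real^'n^'n \<Rightarrow> real^'m^'n \<Rightarrow> real^'n^'p \<Rightarrow> real^'m^'p \<Rightarrow> complex \<Rightarrow> complex^('n + 'm)^('n + 'p)" where
  "pencil A B C D z = system_matrix complex_of_real A B C D z"

definition polynomial_pencil ::
  "real^'n^'n \<Rightarrow> real^'m^'n \<Rightarrow> real^'n^'p \<Rightarrow> real^'m^'p \<Rightarrow> (complex poly)^('n + 'm)^('n + 'p)" where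
  "polynomial_pencil A B C D = system_matrix (\<lambda>a. [:complex_of_real a:]) A B C D [:0, 1:]"

definition normal_rank ::
  "real^'n^'n \<Rightarrow> real^'m^'n \<Rightarrow> real^'n^'p \<Rightarrow> real^'m^'p \<Rightarrow> nat" where
  "normal_rank A B C D = Max (range (\<lambda>z. rank (pencil A B C D z)))"

definition invariant_zeros ::
  "real^'n^'n \<Rightarrow> real^'m^'n \<Rightarrow> real^'n^'p \<Rightarrow> real^'m^'p \<Rightarrow> complex set" where
  "invariant_zeros A B C D = {z. rank (pencil A B C D z) < normal_rank A B C D}"

definition minimum_phase_zeros ::
  "time_domain \<Rightarrow> real^'n^'n \<Rightarrow> real^'m^'n \<Rightarrow> real^'n^'p \<Rightarrow> real^'m^'p \<Rightarrow> complex set" where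
  "minimum_phase_zeros T A B C D = invariant_zeros A B C D \<inter> stability_region T"

definition right_invertible ::
  "real^'n^'n \<Rightarrow> real^'m^'n \<Rightarrow> real^'n^'p \<Rightarrow> real^'m^'p \<Rightarrow> bool" where
  "right_invertible A B C D \<longleftrightarrow>
     finite {z. rank (pencil A B C D z) \<noteq> CARD('n) + CARD('p)}"

definition minors :: "nat \<Rightarrow> 'a::comm_ring_1^'c^'r \<Rightarrow> 'a set" where
  "minors k M = {\<Sum>\<pi> | \<pi> permutes {..<k}. of_int (sign \<pi>) * (\<Prod>a<k. M $ f a $ g (\<pi> a)) | f g.
     inj_on f {..<k} \<and> inj_on g {..<k}}"

text \<open>
  The gcd of the minors of order equal to the normal rank is, up to a unit, the product of the
  invariant polynomials (the nonzero diagonal entries of the Smith form) of the pencil.  The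
  multiplicity of \<open>z\<close> as a root of it is the degree of the product of the elementary divisors at
  \<open>z\<close>, whereas the rank deficiency at \<open>z\<close> is the number of these elementary divisors.
\<close>

definition zero_polynomial ::
  "real^'n^'n \<Rightarrow> real^'m^'n \<Rightarrow> real^'n^'p \<Rightarrow> real^'m^'p \<Rightarrow> complex poly" where
  "zero_polynomial A B C D = Gcd (minors (normal_rank A B C D) (polynomial_pencil A B C D))"

definition zero_algebraic_multiplicity ::
  "real^'n^'n \<Rightarrow> real^'m^'n \<Rightarrow> real^'n^'p \<Rightarrow> real^'m^'p \<Rightarrow> complex \<Rightarrow> nat" where
  "zero_algebraic_multiplicity A B C D z = order z (zero_polynomial A B C D)"

definition zero_geometric_multiplicity ::
  "real^'n^'n \<Rightarrow> real^'m^'n \<Rightarrow> real^'n^'p \<Rightarrow> real^'m^'p \<Rightarrow> complex \<Rightarrow> nat" where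
  "zero_geometric_multiplicity A B C D z = normal_rank A B C D - rank (pencil A B C D z)"


subsection \<open>Output-nulling subspaces\<close>

definition friend ::
  "real^'n^'n \<Rightarrow> real^'m^'n \<Rightarrow> real^'n^'p \<Rightarrow> real^'m^'p \<Rightarrow> (real^'n) set \<Rightarrow> real^'n^'m \<Rightarrow> bool" where
  "friend A B C D V F \<longleftrightarrow>
     (\<forall>v\<in>V. (A + B ** F) *v v \<in> V) \<and> (\<forall>v\<in>V. (C + D ** F) *v v = 0)"

definition output_nulling ::
  "real^'n^'n \<Rightarrow> real^'m^'n \<Rightarrow> real^'n^'p \<Rightarrow> real^'m^'p \<Rightarrow> (real^'n) set \<Rightarrow> bool" where
  "output_nulling A B C D V \<longleftrightarrow> subspace V \<and> (\<exists>F. friend A B C D V F)"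

definition stabilizability_output_nulling ::
  "time_domain \<Rightarrow> real^'n^'n \<Rightarrow> real^'m^'n \<Rightarrow> real^'n^'p \<Rightarrow> real^'m^'p \<Rightarrow> (real^'n) set \<Rightarrow> bool" where
  "stabilizability_output_nulling T A B C D V \<longleftrightarrow> subspace V \<and>
     (\<exists>F. friend A B C D V F \<and> spectrum_on (A + B ** F) V \<subseteq> stability_region T)"

text \<open>Subspaces are ordered by inclusion, so \<open>GREATEST\<close> denotes the largest one.\<close>

definition V_star ::
  "real^'n^'n \<Rightarrow> real^'m^'n \<Rightarrow> real^'n^'p \<Rightarrow> real^'m^'p \<Rightarrow> (real^'n) set" where
  "V_star A B C D = (GREATEST V. output_nulling A B C D V)"

definition V_star_g ::
  "time_domain \<Rightarrow> real^'n^'n \<Rightarrow> real^'m^'n \<Rightarrow> real^'n^'p \<Rightarrow> real^'m^'p \<Rightarrow> (real^'n) set" where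
  "V_star_g T A B C D = (GREATEST V. stabilizability_output_nulling T A B C D V)"

definition smallest_invariant :: "real^'n^'n \<Rightarrow> (real^'n) set \<Rightarrow> (real^'n) set" where
  "smallest_invariant M S = \<Inter>{W. subspace W \<and> S \<subseteq> W \<and> (\<forall>w\<in>W. M *v w \<in> W)}"

text \<open>
  The reachability subspace on an output-nulling subspace \<open>V\<close>: the smallest
  \<open>(A + B F)\<close>-invariant subspace containing the intersection of \<open>V\<close> with \<open>B (ker D)\<close>, where
  \<open>F\<close> is a friend of \<open>V\<close>; it does not depend on which friend is chosen.
\<close>

definition reachability_on ::
  "real^'n^'n \<Rightarrow> real^'m^'n \<Rightarrow> real^'n^'p \<Rightarrow> real^'m^'p \<Rightarrow> (real^'n) set \<Rightarrow> (real^'n) set" where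
  "reachability_on A B C D V =
     smallest_invariant (A + B ** (SOME F. friend A B C D V F)) (V \<inter> {B *v u | u. D *v u = 0})"

definition R_star ::
  "real^'n^'n \<Rightarrow> real^'m^'n \<Rightarrow> real^'n^'p \<Rightarrow> real^'m^'p \<Rightarrow> (real^'n) set" where
  "R_star A B C D = reachability_on A B C D (V_star A B C D)"

text \<open>
  Removal of an output is rendered by a zero row.  This leaves every output-nulling notion the
  same as deletion of the row, because \<open>C\<close> and \<open>D\<close> enter only through the kernels of \<open>C + D F\<close>
  and of \<open>D\<close>.
\<close>

definition drop_row :: "'p \<Rightarrow> real^'c^'p \<Rightarrow> real^'c^'p" where
  "drop_row i M = (\<chi> k. if k = i then 0 else M $ k)"

definition R_star_output ::
  "real^'n^'n \<Rightarrow> real^'m^'n \<Rightarrow> real^'n^'p \<Rightarrow> real^'m^'p \<Rightarrow> 'p \<Rightarrow> (real^'n) set" where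
  "R_star_output A B C D i = R_star A B (drop_row i C) (drop_row i D)"


subsection \<open>The tracking problem\<close>

text \<open>Steady state corresponds to the frequency \<open>0\<close> in continuous and \<open>1\<close> in discrete time.\<close>

fun steady_state_frequency :: "time_domain \<Rightarrow> complex" where
  "steady_state_frequency Continuous = 0"
| "steady_state_frequency Discrete = 1"

fun static_gain ::
  "time_domain \<Rightarrow> real^'n^'n \<Rightarrow> real^'m^'n \<Rightarrow> real^'n^'p \<Rightarrow> real^'m^'p \<Rightarrow> real^'n^'m \<Rightarrow> real^'m^'p" where
  "static_gain Continuous A B C D F = D + (C + D ** F) ** matrix_inv (mat 0 - (A + B ** F)) ** B"
| "static_gain Discrete A B C D F = D + (C + D ** F) ** matrix_inv (mat 1 - (A + B ** F)) ** B"

text \<open>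
  For every constant reference \<open>r\<close> and every trajectory (hence every initial state) under the
  control \<open>u = F x + G r\<close>, the output converges to \<open>r\<close>.
\<close>

fun tracks_constant_references ::
  "time_domain \<Rightarrow> real^'n^'n \<Rightarrow> real^'m^'n \<Rightarrow> real^'n^'p \<Rightarrow> real^'m^'p \<Rightarrow> real^'n^'m \<Rightarrow> real^'p^'m \<Rightarrow> bool"
where
  "tracks_constant_references Continuous A B C D F G \<longleftrightarrow>
     (\<forall>r (x :: real \<Rightarrow> real^'n) u.
        (\<forall>t\<ge>0. u t = F *v x t + G *v r) \<and>
        (\<forall>t\<ge>0. (x has_vector_derivative A *v x t + B *v u t) (at t within {0..})) \<longrightarrow>
        ((\<lambda>t. C *v x t + D *v u t) \<longlongrightarrow> r) at_top)"
| "tracks_constant_references Discrete A B C D F G \<longleftrightarrow>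
     (\<forall>r (x :: nat \<Rightarrow> real^'n) u.
        (\<forall>t. u t = F *v x t + G *v r) \<and>
        (\<forall>t. x (Suc t) = A *v x t + B *v u t) \<longrightarrow>
        (\<lambda>t. C *v x t + D *v u t) \<longlonglongrightarrow> r)"

text \<open>
  Closed-loop modes are indexed by pairs: \<open>(Some i, j)\<close> with \<open>j < \<nu> i\<close> for those observable from
  the \<open>i\<close>-th error component, \<open>(None, j)\<close> with \<open>j < \<nu>\<^sub>0\<close> for the unobservable ones.
\<close>

definition mode_indices :: "nat \<Rightarrow> ('p \<Rightarrow> nat) \<Rightarrow> ('p option \<times> nat) set" where
  "mode_indices \<nu>\<^sub>0 \<nu> = (SIGMA k:UNIV. {..<(case k of None \<Rightarrow> \<nu>\<^sub>0 | Some i \<Rightarrow> \<nu> i)})"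

definition decoupling_modes ::
  "real^'n^'n \<Rightarrow> real^'m^'n \<Rightarrow> real^'n^'p \<Rightarrow> real^'m^'p \<Rightarrow> real^'n^'m \<Rightarrow> nat \<Rightarrow> ('p \<Rightarrow> nat)
     \<Rightarrow> ('p option \<times> nat \<Rightarrow> real) \<Rightarrow> ('p option \<times> nat \<Rightarrow> real^'n) \<Rightarrow> bool" where
  "decoupling_modes A B C D F \<nu>\<^sub>0 \<nu> lam v \<longleftrightarrow>
     inj_on v (mode_indices \<nu>\<^sub>0 \<nu>) \<and>
     independent (v ` mode_indices \<nu>\<^sub>0 \<nu>) \<and>
     span (v ` mode_indices \<nu>\<^sub>0 \<nu>) = UNIV \<and>
     (\<forall>k \<in> mode_indices \<nu>\<^sub>0 \<nu>. (A + B ** F) *v v k = lam k *\<^sub>R v k) \<and>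
     (\<forall>j<\<nu>\<^sub>0. (C + D ** F) *v v (None, j) = 0) \<and>
     (\<forall>i. \<forall>j<\<nu> i. \<exists>c. c \<noteq> 0 \<and> (C + D ** F) *v v (Some i, j) = c *\<^sub>R axis i 1)"

definition problem_1C_solvable ::
  "time_domain \<Rightarrow> real^'n^'n \<Rightarrow> real^'m^'n \<Rightarrow> real^'n^'p \<Rightarrow> real^'m^'p \<Rightarrow> nat \<Rightarrow> ('p \<Rightarrow> nat) \<Rightarrow> bool" where
  "problem_1C_solvable T A B C D \<nu>\<^sub>0 \<nu> \<longleftrightarrow>
     (\<exists>(F :: real^'n^'m) (G :: real^'p^'m).
        spectrum (A + B ** F) \<subseteq> stability_region T \<and>
        static_gain T A B C D F ** G = mat 1 \<and>
        tracks_constant_references T A B C D F G \<and>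
        (\<exists>lam v. decoupling_modes A B C D F \<nu>\<^sub>0 \<nu> lam v \<and>
           (\<forall>i. \<forall>j<\<nu> i. complex_of_real (lam (Some i, j)) \<notin> invariant_zeros A B C D)))"

end

theory Submission
  imports Defs
begin

text \<open>
  A closed-loop eigenvector with real eigenvalue \<open>\<lambda>\<close> is the state part \<open>v\<close> of a pair \<open>(v, w)\<close> with
  \<open>A v + B w = \<lambda> v\<close>, and any basis of such vectors is realised by the feedback \<open>F v = w\<close>.  So the
  problem asks for a basis selected from given sets of vectors: for the unobservable modes those
  with \<open>C v + D w = 0\<close>, for the modes of the \<open>i\<close>-th output those with \<open>C v + D w\<close> a nonzero multiple
  of \<open>e\<^sub>i\<close> and \<open>\<lambda>\<close> not a zero.  By Rado's theorem it exists iff every union of \<open>k\<close> of the sets has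
  dimension at least \<open>k\<close>; the stated inequalities are this condition, provided that the first set
  spans \<open>V\<^sub>g\<^sup>\<star>\<close> and the \<open>i\<close>-th one spans \<open>R\<^sub>i\<^sup>\<star>\<close>.

  Over infinitely many \<open>\<lambda>\<close> the modes span \<open>R\<^sup>\<star>\<close>, by the resolvent identity.  Conversely, where the
  pencil is onto, a kernel vector deforms continuously to kernel vectors at nearby points, which
  generically have their state in \<open>R\<^sup>\<star>\<close>; as \<open>R\<^sup>\<star>\<close> is closed, the original state lies there too.  The same
  deformation, applied to the pencil after dividing out the factors \<open>s - \<lambda>\<close> of its left null rows,
  shows that equality of the two multiplicities excludes Jordan chains modulo \<open>R\<^sup>\<star>\<close>, and hence that
  the modes span \<open>V\<^sub>g\<^sup>\<star>\<close>.
\<close>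

subsection \<open>An independent transversal of a family of sets of vectors\<close>

text \<open>The zeros are the obstacle. One friend of the largest output-nulling subspace
  \<open>V\<close> is fixed, and every other way of staying in \<open>V\<close> with zero output has
  the same action modulo the reachability subspace \<open>R\<close>. Modes thus become eigenvectors
  modulo \<open>R\<close>, and off the zeros all of them lie in \<open>R\<close>. At a minimum-phase
  zero z chains of length two must be excluded, and this is done without the Smith form: if r rows
  of the transformed pencil vanish at z, every full-order minor is divisible by (s - z)^r, where r
  is the geometric multiplicity. A further common factor would make the algebraic multiplicity
  larger, so the pencil is onto at z after the division.

  In the transversal each set is repeated once per mode of its output, so Rado's condition is
  tightest on full blocks. Hence only subsets P of outputs matter, and the two inequalities are the
  blocks with and without the unobservable modes.

  A nonzero output coefficient is not a linear condition. It costs nothing in the span, since a mode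
  with zero output is a difference of two observable modes with the same eigenvalue.\<close>

lemma dim_Un_Int_le:
  fixes X Y :: "'a::euclidean_space set"
  assumes "Z \<subseteq> span X" "Z \<subseteq> span Y"
  shows "dim (X \<union> Y) + dim Z \<le> dim X + dim Y"
proof -
  have "dim {x + y |x y. x \<in> span X \<and> y \<in> span Y} + dim (span X \<inter> span Y) = dim (span X) + dim (span Y)"
    by (rule dim_sums_Int) auto
  moreover have "{x + y |x y. x \<in> span X \<and> y \<in> span Y} = span (X \<union> Y)"
    by (auto simp: span_Un)
  moreover have "dim Z \<le> dim (span X \<inter> span Y)"
    using assms by (intro dim_subset) auto
  ultimately show ?thesis by simp
qed

lemma independent_if_card_le_dim:
  fixes v :: "'k \<Rightarrow> 'a::euclidean_space"
  assumes "finite K" "card K \<le> dim (v ` K)"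
  shows "inj_on v K" "independent (v ` K)"
proof -
  have "card K \<le> card (v ` K)"
    using assms dim_le_card'[of "v ` K"] by auto
  then have eq: "card (v ` K) = card K"
    using card_image_le[OF assms(1), of v] by auto
  then show "inj_on v K"
    using assms(1) eq_card_imp_inj_on by blast
  show "independent (v ` K)"
    using assms eq by (intro card_le_dim_spanning[of _ "span (v ` K)"]) (auto simp: span_superset)
qed

text \<open>Rado's theorem by deletion. As long as some set has two elements, one of them can be
  removed without violating the condition. Once all sets are singletons, the condition for
  \<open>K\<close> itself says that the remaining vectors are independent.\<close>

lemma finite_independent_transversal:
  fixes S :: "'k \<Rightarrow> 'a::euclidean_space set"
  assumes "finite K" "\<And>k. k \<in> K \<Longrightarrow> finite (S k)"
    and "\<And>J. J \<subseteq> K \<Longrightarrow> card J \<le> dim (\<Union>k\<in>J. S k)"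
  shows "\<exists>v. (\<forall>k\<in>K. v k \<in> S k) \<and> inj_on v K \<and> independent (v ` K)"
  using assms(2,3)
proof (induction "\<Sum>k\<in>K. card (S k)" arbitrary: S rule: less_induct)
  case less
  have ne: "S k \<noteq> {}" if "k \<in> K" for k
    using less.prems(2)[of "{k}"] that by auto
  show ?case
  proof (cases "\<exists>k\<in>K. \<exists>a\<in>S k. \<exists>b\<in>S k. a \<noteq> b")
    case False
    define v where "v k = (SOME x. x \<in> S k)" for k
    have v: "v k \<in> S k" if "k \<in> K" for k
      using ne[OF that] by (auto simp: v_def intro: someI_ex)
    then have "S k = {v k}" if "k \<in> K" for k
      using False that by blast
    then have "(\<Union>k\<in>K. S k) = v ` K" by auto
    then have "card K \<le> dim (v ` K)"
      using less.prems(2)[of K] by simp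
    then show ?thesis
      using v independent_if_card_le_dim[OF assms(1)] by blast
  next
    case True
    then obtain k a b where k: "k \<in> K" and ab: "a \<in> S k" "b \<in> S k" "a \<noteq> b" by blast
    define S' where "S' c = S(k := S k - {c})" for c
    have smaller: "(\<Sum>l\<in>K. card (S' c l)) < (\<Sum>l\<in>K. card (S l))" if "c \<in> S k" for c
      using that less.prems(1) k assms(1)
      by (intro sum_strict_mono_ex1)
        (auto simp: S'_def card_Diff1_le card_gt_0_iff intro!: bexI[of _ k] diff_less)
    \<comment> \<open>If both deletions fail, the violating \<open>J1\<close> and \<open>J2\<close>
      contain \<open>k\<close>, and their dimensions add up to at most card J1 + card J2 - 2.
      Submodularity bounds the same sum from below by card (J1 \<union> J2) + card (J1 \<inter> J2 -
      {k}) = card J1 + card J2 - 1. The union keeps all of \<open>S k\<close> because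
      \<open>a\<close> and \<open>b\<close> differ.\<close>
    have "\<exists>c\<in>{a, b}. \<forall>J. J \<subseteq> K \<longrightarrow> card J \<le> dim (\<Union>l\<in>J. S' c l)"
    proof (rule ccontr)
      assume "\<not> ?thesis"
      then obtain J1 J2 where J: "J1 \<subseteq> K" "dim (\<Union>l\<in>J1. S' a l) < card J1"
          "J2 \<subseteq> K" "dim (\<Union>l\<in>J2. S' b l) < card J2"
        by (meson insertI1 insertI2 not_le)
      have kJ: "k \<in> J1" "k \<in> J2"
      proof -
        have "(\<Union>l\<in>J. S' c l) = (\<Union>l\<in>J. S l)" if "k \<notin> J" for J c
          using that by (auto simp: S'_def split: if_splits)
        then show "k \<in> J1" "k \<in> J2"
          using J less.prems(2)[of J1] less.prems(2)[of J2] by (metis not_le)+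
      qed
      let ?X = "\<Union>l\<in>J1. S' a l" and ?Y = "\<Union>l\<in>J2. S' b l" and ?Z = "\<Union>l\<in>J1 \<inter> J2 - {k}. S l"
      have fin: "finite J1" "finite J2" using J assms(1) finite_subset by auto
      have "?Z \<subseteq> ?X" "?Z \<subseteq> ?Y"
        by (auto simp: S'_def)
      then have "dim (?X \<union> ?Y) + dim ?Z \<le> dim ?X + dim ?Y"
        by (intro dim_Un_Int_le) (meson span_superset subset_trans)+
      moreover have "card (J1 \<union> J2) \<le> dim (?X \<union> ?Y)"
      proof -
        have "S k \<subseteq> S' a k \<union> S' b k" using ab by (auto simp: S'_def)
        then have "(\<Union>l\<in>J1 \<union> J2. S l) \<subseteq> ?X \<union> ?Y"
          using kJ by (fastforce simp: S'_def split: if_splits)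
        then show ?thesis
          using less.prems(2)[of "J1 \<union> J2"] J dim_subset by (meson Un_least le_trans)
      qed
      moreover have "card (J1 \<inter> J2 - {k}) \<le> dim ?Z"
        using J by (intro less.prems(2)) auto
      moreover have "card (J1 \<inter> J2 - {k}) = card (J1 \<inter> J2) - 1" "card (J1 \<inter> J2) > 0"
        using kJ fin by (auto simp: card_gt_0_iff)
      moreover have "card (J1 \<union> J2) + card (J1 \<inter> J2) = card J1 + card J2"
        using fin card_Un_Int by metis
      ultimately show False using J by linarith
    qed
    then obtain c where c: "c \<in> {a, b}" "\<And>J. J \<subseteq> K \<Longrightarrow> card J \<le> dim (\<Union>l\<in>J. S' c l)" by blast
    have cS: "c \<in> S k" using c(1) ab by auto
    have "\<exists>v. (\<forall>k\<in>K. v k \<in> S' c k) \<and> inj_on v K \<and> independent (v ` K)"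
      using less.prems(1) by (intro less.hyps[OF smaller[OF cS]] c(2)) (auto simp: S'_def)
    then show ?thesis
      by (metis (no_types, lifting) Diff_iff S'_def fun_upd_other fun_upd_same)
  qed
qed

text \<open>Passing to a maximal independent subset makes each set finite and keeps its span, so
  Rado's condition survives.\<close>

theorem independent_transversal:
  fixes S :: "'k \<Rightarrow> 'a::euclidean_space set"
  assumes "finite K" "\<And>J. J \<subseteq> K \<Longrightarrow> card J \<le> dim (\<Union>k\<in>J. S k)"
  shows "\<exists>v. (\<forall>k\<in>K. v k \<in> S k) \<and> inj_on v K \<and> independent (v ` K)"
proof -
  have "\<exists>b. b \<subseteq> S k \<and> independent b \<and> S k \<subseteq> span b" for k
    by (meson maximal_independent_subset)
  then obtain b where b: "\<And>k. b k \<subseteq> S k" "\<And>k. independent (b k)" "\<And>k. S k \<subseteq> span (b k)" by metis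
  have "dim (\<Union>k\<in>J. S k) \<le> dim (\<Union>k\<in>J. b k)" for J
  proof -
    have "(\<Union>k\<in>J. S k) \<subseteq> span (\<Union>k\<in>J. b k)"
      using b(3) span_mono by (smt (verit, best) UN_least UN_upper subset_trans)
    then show ?thesis by (metis dim_span dim_subset)
  qed
  then have "\<exists>v. (\<forall>k\<in>K. v k \<in> b k) \<and> inj_on v K \<and> independent (v ` K)"
    using assms b(2) by (intro finite_independent_transversal)
      (auto simp: finiteI_independent intro: le_trans)
  then show ?thesis using b(1) by blast
qed

subsection \<open>Perturbation of kernel vectors\<close>

text \<open>
  If \<open>e = f \<circ> g\<close>, then \<open>f - t e = f \<circ> (1 - t g)\<close>, so \<open>(1 - t g)\<inverse> \<eta>\<close> is in the kernel of \<open>f - t e\<close>.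
\<close>

lemma kernel_perturbation:
  fixes f e :: "'a::euclidean_space \<Rightarrow> 'b::euclidean_space"
  assumes f: "linear f" and e: "linear e" and "range e \<subseteq> range f" and "f \<eta> = 0"
  obtains \<delta> c where "\<delta> > 0" "\<And>t. \<bar>t\<bar> < \<delta> \<Longrightarrow> \<exists>\<xi>. f \<xi> = t *\<^sub>R e \<xi> \<and> norm (\<xi> - \<eta>) \<le> \<bar>t\<bar> * c"
proof -
  obtain r where r: "linear r" "\<And>y. y \<in> range f \<Longrightarrow> f (r y) = y"
    using linear_exists_right_inverse_on[OF f subspace_UNIV] by blast
  define g where "g = r \<circ> e"
  have g: "linear g" and fg: "f (g x) = e x" for x
    using r e assms(3) by (auto simp: g_def intro: linear_compose)
  obtain b where b: "b > 0" "\<And>x. norm (g x) \<le> b * norm x"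
    using linear_bounded_pos[OF g] by blast
  \<comment> \<open>For \<bar>t\<bar> < 1 / (2 b) the map t g has norm at most 1/2, so 1 - t g is
    invertible and norm \<xi> \<le> 2 * norm \<eta>. The second constant then bounds \<xi> - \<eta>
    = t g \<xi>.\<close>
  show ?thesis
  proof (rule that[of "1 / (2 * b)" "2 * b * norm \<eta>"])
    show "1 / (2 * b) > 0" using b by simp
    fix t :: real assume t: "\<bar>t\<bar> < 1 / (2 * b)"
    define h where "h x = x - t *\<^sub>R g x" for x
    have h: "linear h"
      unfolding h_def by (intro linear_compose_sub linear_ident linear_compose_scale_right g)
    have small: "norm (t *\<^sub>R g x) \<le> norm x / 2" for x
    proof -
      have "norm (t *\<^sub>R g x) \<le> \<bar>t\<bar> * (b * norm x)" using b by (simp add: mult_left_mono)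
      also have "\<dots> \<le> (1 / (2 * b)) * (b * norm x)" using t b by (intro mult_right_mono) auto
      finally show ?thesis using b by simp
    qed
    have "x = 0" if "h x = 0" for x
    proof -
      have "norm x \<le> norm x / 2"
        using small[of x] that by (simp only: h_def eq_iff_diff_eq_0[symmetric])
      then show ?thesis by simp
    qed
    then have "surj h"
      using h linear_injective_0 linear_injective_imp_surjective by blast
    then obtain \<xi> where \<xi>: "\<eta> = h \<xi>" by (meson surjD)
    have "norm \<xi> \<le> 2 * norm \<eta>"
    proof -
      have "norm \<xi> \<le> norm \<eta> + norm (t *\<^sub>R g \<xi>)"
        using \<xi> by (metis add_diff_cancel_right' diff_add_cancel h_def norm_triangle_ineq)
      then show ?thesis using small[of \<xi>] by simp
    qed
    moreover have "norm (\<xi> - \<eta>) \<le> \<bar>t\<bar> * (b * norm \<xi>)"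
      using \<xi> b by (simp add: h_def mult_left_mono)
    ultimately have "norm (\<xi> - \<eta>) \<le> \<bar>t\<bar> * (b * (2 * norm \<eta>))"
      using b by (meson abs_ge_zero less_imp_le mult_left_mono order_trans)
    moreover have "f \<xi> = t *\<^sub>R e \<xi>"
    proof -
      have "f \<eta> = f \<xi> - t *\<^sub>R f (g \<xi>)"
        using \<xi> by (simp add: h_def linear_diff[OF f] linear_scale[OF f])
      then show ?thesis using assms(4) fg by simp
    qed
    ultimately show "\<exists>\<xi>. f \<xi> = t *\<^sub>R e \<xi> \<and> norm (\<xi> - \<eta>) \<le> \<bar>t\<bar> * (2 * b * norm \<eta>)"
      by (intro exI[of _ \<xi>]) (simp add: algebra_simps)
  qed
qed

section \<open>Bijectivity of a linear map on an invariant subspace\<close>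

lemma linear_image_eq_of_injective:
  fixes f :: "'a::euclidean_space \<Rightarrow> 'a"
  assumes "linear f" "subspace S" "\<And>x. x \<in> S \<Longrightarrow> f x \<in> S" "\<And>x. x \<in> S \<Longrightarrow> f x = 0 \<Longrightarrow> x = 0"
  shows "f ` S = S"
proof -
  have "inj_on f S"
    using assms(1,2,4) by (simp add: linear_inj_on_iff_eq_0)
  then have "dim (f ` S) = dim S"
    using assms(1,2) by (intro dim_image_eq) (auto simp: span_eq_iff[THEN iffD2])
  then show ?thesis
    using assms subspace_dim_equal[of "f ` S" S] linear_subspace_image by (metis image_subsetI order_refl)
qed

text \<open>Surjectivity can be checked on generators, injectivity cannot; finite dimension turns
  the former into the latter.\<close>

lemma linear_injective_on_of_image_eq:
  fixes f :: "'a::euclidean_space \<Rightarrow> 'a"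
  assumes "linear f" "subspace S" "S \<subseteq> f ` S" "x \<in> S" "f x = 0"
  shows "x = 0"
proof -
  obtain B where B: "B \<subseteq> S" "independent B" "S \<subseteq> span B" "card B = dim S"
    using basis_exists by blast
  have S: "S = span B"
    using B assms(2) by (simp add: span_minimal subset_antisym)
  have "card B \<le> dim (f ` B)"
    using B(4) assms(1,3) S by (metis dim_span dim_subset linear_span_image)
  then have "inj_on f B" "independent (f ` B)"
    using independent_if_card_le_dim finiteI_independent[OF B(2)] by blast+
  then have "inj_on f S"
    using assms(1) S linear_inj_on_span_independent_image by blast
  then show ?thesis
    using assms linear_0 subspace_0 by (metis inj_onD)
qed

subsection \<open>Complexification\<close>

definition re_vec :: "complex^'n \<Rightarrow> real^'n" where "re_vec w = (\<chi> k. Re (w $ k))"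
definition im_vec :: "complex^'n \<Rightarrow> real^'n" where "im_vec w = (\<chi> k. Im (w $ k))"
definition of_real_vec :: "real^'n \<Rightarrow> complex^'n" where "of_real_vec x = (\<chi> k. complex_of_real (x $ k))"
definition complexify :: "(real^'n) set \<Rightarrow> (complex^'n) set" where
  "complexify S = {w. re_vec w \<in> S \<and> im_vec w \<in> S}"

lemma re_im_vec_simps [simp]:
  "re_vec (v + w) = re_vec v + re_vec w" "im_vec (v + w) = im_vec v + im_vec w"
  "re_vec (v - w) = re_vec v - re_vec w" "im_vec (v - w) = im_vec v - im_vec w"
  "re_vec (- w) = - re_vec w" "im_vec (- w) = - im_vec w"
  "re_vec (c *\<^sub>R w) = c *\<^sub>R re_vec w" "im_vec (c *\<^sub>R w) = c *\<^sub>R im_vec w"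
  "re_vec (z *s w) = Re z *\<^sub>R re_vec w - Im z *\<^sub>R im_vec w"
  "im_vec (z *s w) = Re z *\<^sub>R im_vec w + Im z *\<^sub>R re_vec w"
  "re_vec (0 :: complex^'n) = 0" "im_vec (0 :: complex^'n) = 0"
  "re_vec (of_real_vec x) = x" "im_vec (of_real_vec x) = 0"
  for v w :: "complex^'n"
  by (simp_all add: re_vec_def im_vec_def of_real_vec_def vec_eq_iff)

lemma re_im_vec_mult [simp]:
  "re_vec (complex_matrix M *v w) = M *v re_vec w"
  "im_vec (complex_matrix M *v w) = M *v im_vec w"
  by (simp_all add: re_vec_def im_vec_def complex_matrix_def matrix_vector_mult_def vec_eq_iff)

lemma complex_vec_eq_iff: "v = w \<longleftrightarrow> re_vec v = re_vec w \<and> im_vec v = im_vec w"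
  by (auto simp: re_vec_def im_vec_def vec_eq_iff complex_eq_iff)

lemma of_real_vec_simps:
  "of_real_vec (x + y) = of_real_vec x + of_real_vec y"
  "of_real_vec (x - y) = of_real_vec x - of_real_vec y"
  "of_real_vec (c *\<^sub>R x) = of_real c *s of_real_vec x"
  "of_real_vec 0 = 0"
  "complex_matrix M *v of_real_vec x = of_real_vec (M *v x)"
  by (simp_all add: complex_vec_eq_iff matrix_vector_mult_0_right)

lemma complex_vec_decompose: "w = of_real_vec (re_vec w) + \<i> *s of_real_vec (im_vec w)"
  by (simp add: complex_vec_eq_iff)

lemma scaleR_eq_smult: "c *\<^sub>R w = of_real c *s w" for w :: "complex^'n"
  by (simp add: complex_vec_eq_iff)

lemma complex_matrix_closed_loop:
  "complex_matrix (A + B ** F) *v w = complex_matrix A *v w + complex_matrix B *v (complex_matrix F *v w)"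
  by (simp add: complex_vec_eq_iff matrix_vector_mult_add_rdistrib matrix_vector_mul_assoc
      del: matrix_vector_mul_assoc) (simp add: matrix_vector_mul_assoc)

lemma subspace_complexify: "subspace S \<Longrightarrow> subspace (complexify S)"
  unfolding subspace_def complexify_def by simp

lemma complexify_smult: "subspace S \<Longrightarrow> w \<in> complexify S \<Longrightarrow> z *s w \<in> complexify S"
  by (simp add: complexify_def subspace_diff subspace_add subspace_scale)

lemma complexify_mono: "S \<subseteq> S' \<Longrightarrow> complexify S \<subseteq> complexify S'"
  by (auto simp: complexify_def)

lemma of_real_vec_in_complexify [simp]: "subspace S \<Longrightarrow> of_real_vec x \<in> complexify S \<longleftrightarrow> x \<in> S"
  by (simp add: complexify_def subspace_0)

lemma closed_complexify:
  assumes "subspace S" shows "closed (complexify S)"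
  using closed_subspace[OF subspace_complexify[OF assms]] .

text \<open>The complexification of a real span is the complex span of the same real generators. The
  scalars here are complex, while the base case concerns real vectors only.\<close>

lemma complexify_span_induct [consumes 1, case_names base add smult zero]:
  assumes w: "w \<in> complexify (span G)"
    and base: "\<And>v. v \<in> G \<Longrightarrow> Q (of_real_vec v)"
    and add: "\<And>v w. Q v \<Longrightarrow> Q w \<Longrightarrow> Q (v + w)"
    and smult: "\<And>z v. Q v \<Longrightarrow> Q (z *s v)"
    and zero: "Q 0"
  shows "Q w"
proof -
  have "Q (of_real_vec v)" if "v \<in> span G" for v
    using that
    by (induction rule: span_induct_alt) (auto simp: of_real_vec_simps zero intro!: add smult base)
  then have "Q (of_real_vec (re_vec w) + \<i> *s of_real_vec (im_vec w))"
    using w by (intro add smult) (auto simp: complexify_def)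
  then show ?thesis using complex_vec_decompose[of w] by simp
qed

abbreviation shifted :: "real^'n^'n \<Rightarrow> complex \<Rightarrow> complex^'n \<Rightarrow> complex^'n" where
  "shifted M z w \<equiv> complex_matrix M *v w - z *s w"

lemma shifted_linear:
  "shifted M z (v + w) = shifted M z v + shifted M z w"
  "shifted M z (v - w) = shifted M z v - shifted M z w"
  "shifted M z (c *s w) = c *s shifted M z w"
  "shifted M z (r *\<^sub>R w) = r *\<^sub>R shifted M z w"
  "shifted M z 0 = 0"
  by (simp_all add: complex_vec_eq_iff matrix_vector_right_distrib matrix_vector_mult_diff_distrib
      matrix_vector_mult_scaleR algebra_simps)

lemma linear_shifted: "linear (shifted M z)"
  by (rule linearI) (rule shifted_linear)+

lemma shifted_closed:
  assumes "subspace S" "\<And>x. x \<in> S \<Longrightarrow> M *v x \<in> S" "w \<in> complexify S"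
  shows "shifted M z w \<in> complexify S"
proof -
  have "complex_matrix M *v w \<in> complexify S"
    using assms by (simp add: complexify_def)
  then show ?thesis
    using assms complexify_smult subspace_complexify subspace_diff by metis
qed

lemma spectrum_on_alt: "spectrum_on M V = {z. \<exists>w. w \<noteq> 0 \<and> w \<in> complexify V \<and> shifted M z w = 0}"
  by (simp add: spectrum_on_def complexify_def re_vec_def im_vec_def)

text \<open>For z outside \<Lambda> the shifted matrix multiplies each generator by l - z, which is
  nonzero. It is therefore onto the complexified span and so has no kernel there.\<close>

lemma spectrum_on_eigenvectors:
  assumes "\<And>v. v \<in> G \<Longrightarrow> \<exists>l. of_real l \<in> \<Lambda> \<and> M *v v = l *\<^sub>R v"
  shows "spectrum_on M (span G) \<subseteq> \<Lambda>"
proof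
  fix z assume "z \<in> spectrum_on M (span G)"
  then obtain w where w: "w \<noteq> 0" "w \<in> complexify (span G)" "shifted M z w = 0"
    by (auto simp: spectrum_on_alt)
  show "z \<in> \<Lambda>"
  proof (rule ccontr)
    assume z: "z \<notin> \<Lambda>"
    let ?S = "complexify (span G)"
    have sub: "subspace ?S" by (simp add: subspace_complexify)
    have "x \<in> shifted M z ` ?S" if "x \<in> ?S" for x
      using that
    proof (induction rule: complexify_span_induct)
      case (base v)
      then obtain l where l: "of_real l \<in> \<Lambda>" "M *v v = l *\<^sub>R v" using assms by blast
      then have "of_real l - z \<noteq> 0" using z by auto
      moreover have "shifted M z (of_real_vec v) = (of_real l - z) *s of_real_vec v"
        by (simp add: of_real_vec_simps l vec.scale_left_diff_distrib)
      moreover have "(1 / (of_real l - z)) *s ((of_real l - z) *s of_real_vec v) = of_real_vec v"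
        using \<open>of_real l - z \<noteq> 0\<close> by (simp only: vec.scale_scale) simp
      ultimately have "of_real_vec v = shifted M z ((1 / (of_real l - z)) *s of_real_vec v)"
        by (simp only: shifted_linear(3))
      moreover have "of_real_vec v \<in> ?S" using base by (simp add: span_base)
      ultimately show ?case by (rule_tac image_eqI[OF _ complexify_smult[OF subspace_span]])
    next
      case (add v w)
      then obtain x y where "x \<in> ?S" "v = shifted M z x" "y \<in> ?S" "w = shifted M z y" by auto
      then show ?case
        using subspace_add[OF sub] by (intro image_eqI[of _ _ "x + y"]) (simp_all only: shifted_linear(1))
    next
      case (smult c v)
      then obtain x where "x \<in> ?S" "v = shifted M z x" by auto
      then show ?case
        using complexify_smult[OF subspace_span]
        by (intro image_eqI[of _ _ "c *s x"]) (simp_all only: shifted_linear(3))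
    next
      case zero
      show ?case by (rule image_eqI[of _ _ 0]) (simp_all only: shifted_linear(5) subspace_0[OF sub])
    qed
    then have "w = 0"
      using linear_injective_on_of_image_eq[OF linear_shifted sub _ w(2,3)] by blast
    then show False using w by simp
  qed
qed

lemma real_eigenvalue_in_spectrum: "M *v v = l *\<^sub>R v \<Longrightarrow> v \<noteq> 0 \<Longrightarrow> of_real l \<in> spectrum M"
  unfolding spectrum_on_alt
  by (intro CollectI exI[of _ "of_real_vec v"]) (auto simp: complex_vec_eq_iff complexify_def)

lemma finite_spectrum: "finite (spectrum M)" for M :: "real^'n^'n"
proof (rule ccontr)
  assume "infinite (spectrum M)"
  \<comment> \<open>\<open>independent\<close> is over the reals, so the count is against the real
    dimension of the complex space. The complex independence of eigenvectors shown below is stronger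
    than what this needs.\<close>
  then obtain Z where Z: "finite Z" "card Z = Suc (DIM(complex^'n))" "Z \<subseteq> spectrum M"
    using infinite_arbitrarily_large by metis
  have "\<forall>z\<in>Z. \<exists>w. w \<noteq> 0 \<and> shifted M z w = 0"
    using Z(3) by (auto simp: spectrum_on_alt)
  then obtain w where w: "\<And>z. z \<in> Z \<Longrightarrow> w z \<noteq> 0" "\<And>z. z \<in> Z \<Longrightarrow> shifted M z (w z) = 0" by metis
  have ind: "\<forall>z\<in>Y. c z = 0" if "finite Y" "Y \<subseteq> Z" "(\<Sum>z\<in>Y. c z *s w z) = 0" for Y c
    using that
  proof (induction Y arbitrary: c rule: finite_induct)
    case (insert a Y)
    \<comment> \<open>The shift by \<open>a\<close> kills the term of \<open>a\<close> and
      multiplies that of \<open>z\<close> by z - a, which leaves a shorter relation.\<close>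
    have lin: "shifted M a (\<Sum>z\<in>Y. c z *s w z) = (\<Sum>z\<in>Y. (c z * (z - a)) *s w z)"
    proof -
      have "shifted M a (\<Sum>z\<in>Y. c z *s w z) = (\<Sum>z\<in>Y. shifted M a (c z *s w z))"
        using linear_sum[OF linear_shifted[of M a]] by blast
      also have "\<dots> = (\<Sum>z\<in>Y. (c z * (z - a)) *s w z)"
      proof (rule sum.cong[OF refl])
        fix z assume "z \<in> Y"
        then have "complex_matrix M *v w z = z *s w z" using w(2) insert.prems by auto
        then show "shifted M a (c z *s w z) = (c z * (z - a)) *s w z"
          by (simp only: shifted_linear(3)) (simp add: vec.scale_left_diff_distrib algebra_simps)
      qed
      finally show ?thesis .
    qed
    have "(\<Sum>z\<in>Y. c z *s w z) = - (c a *s w a)"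
      using insert by (simp add: eq_neg_iff_add_eq_0 add.commute)
    then have "shifted M a (\<Sum>z\<in>Y. c z *s w z) = - (c a *s shifted M a (w a))"
      by (simp only: shifted_linear(3)[symmetric] linear_neg[OF linear_shifted])
    moreover have "shifted M a (w a) = 0" using w(2) insert.prems by blast
    ultimately have "(\<Sum>z\<in>Y. (c z * (z - a)) *s w z) = - (c a *s 0)"
      by (simp only: lin)
    then have "(\<Sum>z\<in>Y. (c z * (z - a)) *s w z) = 0" by (simp only: vec.scale_zero_right neg_0_equal_iff_equal minus_zero)
    then have "\<forall>z\<in>Y. c z * (z - a) = 0"
      using insert.prems(1) by (intro insert.IH) auto
    then have "\<forall>z\<in>Y. c z = 0" using insert.hyps by auto
    moreover from this have "c a *s w a = 0"
      using insert by simp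
    then have "c a = 0" using w(1) insert.prems by auto
    ultimately show ?case by simp
  qed simp
  have inj: "inj_on w Z"
  proof (rule inj_onI)
    fix x y assume xy: "x \<in> Z" "y \<in> Z" "w x = w y"
    then have "x *s w x = y *s w x" using w(2)[of x] w(2)[of y] by simp
    then have "(x - y) *s w x = 0" by (simp add: vec.scale_left_diff_distrib)
    then show "x = y" using w(1) xy by auto
  qed
  have "independent (w ` Z)"
  proof (rule independent_if_scalars_zero)
    show "finite (w ` Z)" using Z by simp
    fix f x assume "(\<Sum>x\<in>w ` Z. f x *\<^sub>R x) = 0" and x: "x \<in> w ` Z"
    then have "(\<Sum>z\<in>Z. of_real (f (w z)) *s w z) = 0"
      by (simp add: sum.reindex[OF inj] scaleR_eq_smult)
    then show "f x = 0" using ind[OF Z(1) order.refl] x by fastforce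
  qed
  then have "card (w ` Z) \<le> DIM(complex^'n)"
    using independent_bound by blast
  then show False using Z card_image[OF inj] by simp
qed

subsection \<open>The pencil as a map on pairs of a state and an input\<close>

definition upper :: "'a^('n::finite + 'm::finite) \<Rightarrow> 'a^'n" where "upper \<xi> = (\<chi> i. \<xi> $ Inl i)"
definition lower :: "'a^('n::finite + 'm::finite) \<Rightarrow> 'a^'m" where "lower \<xi> = (\<chi> i. \<xi> $ Inr i)"
definition stack :: "'a^'n \<Rightarrow> 'a^'m \<Rightarrow> 'a^('n::finite + 'm::finite)" where
  "stack x u = (\<chi> c. case c of Inl i \<Rightarrow> x $ i | Inr j \<Rightarrow> u $ j)"

lemma stack_simps [simp]: "upper (stack x u) = x" "lower (stack x u) = u" "stack (upper \<xi>) (lower \<xi>) = \<xi>"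
  by (auto simp: upper_def lower_def stack_def vec_eq_iff split: sum.split)

lemma stack_eq_iff: "\<xi> = \<eta> \<longleftrightarrow> upper \<xi> = upper \<eta> \<and> lower \<xi> = lower \<eta>"
  by (metis stack_simps(3))

lemma upper_lower_simps [simp]:
  "upper (\<xi> + \<eta>) = upper \<xi> + upper \<eta>" "lower (\<xi> + \<eta>) = lower \<xi> + lower \<eta>"
  "upper (\<xi> - \<eta>) = upper \<xi> - upper \<eta>" "lower (\<xi> - \<eta>) = lower \<xi> - lower \<eta>"
  "upper (c *\<^sub>R \<xi>) = c *\<^sub>R upper \<xi>" "lower (c *\<^sub>R \<xi>) = c *\<^sub>R lower \<xi>"
  "upper (0 :: complex^('n::finite + 'm::finite)) = 0" "lower (0 :: complex^('n::finite + 'm::finite)) = 0"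
  for \<xi> \<eta> :: "complex^('n::finite + 'm::finite)"
  by (simp_all add: upper_def lower_def vec_eq_iff)

lemma norm_upper_le: "norm (upper \<xi>) \<le> norm \<xi>" for \<xi> :: "complex^('n::finite + 'm::finite)"
proof -
  have "(\<Sum>i\<in>UNIV. (norm (\<xi> $ Inl i))\<^sup>2) \<le> (\<Sum>c\<in>UNIV. (norm (\<xi> $ c))\<^sup>2)"
    by (subst UNIV_Plus_UNIV[symmetric], subst sum.Plus) (auto intro: sum_nonneg)
  then show ?thesis
    by (simp add: norm_vec_def L2_set_def upper_def)
qed

lemma pencil_mult:
  fixes \<xi> :: "complex^('n::finite + 'm::finite)"
  shows "pencil A B C D z *v \<xi> =
    stack (complex_matrix A *v upper \<xi> + complex_matrix B *v lower \<xi> - z *s upper \<xi>)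
      (complex_matrix C *v upper \<xi> + complex_matrix D *v lower \<xi>)"
proof -
  have "(\<Sum>c\<in>UNIV. f c) = (\<Sum>i\<in>UNIV. f (Inl i)) + (\<Sum>j\<in>UNIV. f (Inr j))" for f :: "'n + 'm \<Rightarrow> complex"
    by (subst UNIV_Plus_UNIV[symmetric], subst sum.Plus) auto
  then show ?thesis
    by (auto simp: stack_eq_iff upper_def lower_def stack_def vec_eq_iff pencil_def system_matrix_def
        matrix_vector_mult_def complex_matrix_def left_diff_distrib sum_subtractf if_distrib[of "\<lambda>x. x * _"]
        cong: if_cong)
qed

lemma pencil_mult_eq_0_iff:
  "pencil A B C D z *v \<xi> = 0 \<longleftrightarrow>
     complex_matrix A *v upper \<xi> + complex_matrix B *v lower \<xi> = z *s upper \<xi> \<and>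
     complex_matrix C *v upper \<xi> + complex_matrix D *v lower \<xi> = 0"
  by (simp add: pencil_mult stack_eq_iff)

text \<open>This puts the pencil near z into the form f - t e of
  \<open>kernel_perturbation\<close>.\<close>

lemma pencil_add_mult:
  "pencil A B C D (z + of_real t) *v \<xi> = pencil A B C D z *v \<xi> - t *\<^sub>R stack (upper \<xi>) 0"
  by (simp add: pencil_mult stack_eq_iff) (simp add: scaleR_eq_smult vec.scale_left_distrib)

lemma linear_matrix_vector_mult: "linear ((*v) M)" for M :: "complex^'c^'r"
  by (rule linearI) (simp_all add: matrix_vector_right_distrib scaleR_eq_smult vec.scale)

section \<open>Full row rank and surjectivity of the pencil\<close>

lemma finite_rows: "finite (rows M)"
  by (simp add: rows_def full_SetCompr_eq)

lemma rank_le_card_rows: "rank M \<le> CARD('r)" for M :: "'a::field^'c^'r"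
proof -
  have "rank M \<le> card (rows M)"
    unfolding row_rank_def_gen by (rule vec.dim_le_card') (simp add: finite_rows)
  also have "\<dots> \<le> CARD('r)"
    using card_image_le[of UNIV "\<lambda>i. row i M"] by (simp add: rows_def full_SetCompr_eq)
  finally show ?thesis .
qed

lemma full_row_rank_imp_surj:
  fixes M :: "complex^'c^'r"
  assumes "rank M = CARD('r)" shows "surj ((*v) M)"
proof -
  have rows: "rows M = (\<lambda>i. row i M) ` UNIV" by (auto simp: rows_def)
  have c: "card (rows M) = CARD('r)"
    using assms vec.dim_le_card'[of "rows M"] card_image_le[of UNIV "\<lambda>i. row i M"]
    by (simp add: row_rank_def_gen finite_rows) (simp add: rows)
  then have inj: "inj (\<lambda>i. row i M)"
    by (simp add: rows eq_card_imp_inj_on)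
  have "vec.independent (rows M)"
    using assms c by (intro vec.card_le_dim_spanning[of _ "vec.span (rows M)"])
      (auto simp: row_rank_def_gen vec.span_superset finite_rows)
  then have "\<forall>c. (\<Sum>i\<in>UNIV. c i *s row i M) = 0 \<longrightarrow> (\<forall>i. c i = 0)"
  proof (intro allI impI)
    fix c i assume "(\<Sum>i\<in>UNIV. c i *s row i M) = 0"
    then have "(\<Sum>v\<in>rows M. c (inv (\<lambda>i. row i M) v) *s v) = 0"
      using inv_f_f[OF inj] by (simp add: rows sum.reindex[OF inj])
    then have "c (inv (\<lambda>i. row i M) (row i M)) = 0"
      using vec.independentD[OF \<open>vec.independent (rows M)\<close> finite_rows order.refl, of "\<lambda>v. c (inv (\<lambda>i. row i M) v)"]
      by (simp add: rows)
    then show "c i = 0" using inv_f_f[OF inj, of i] by simp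
  qed
  then show ?thesis
    using matrix_right_invertible_independent_rows matrix_right_invertible_surjective by blast
qed

lemma full_normal_rank:
  fixes A :: "real^'n^'n" and B :: "real^'m^'n" and C :: "real^'n^'p" and D :: "real^'m^'p"
  assumes "right_invertible A B C D"
  shows "normal_rank A B C D = CARD('n) + CARD('p)"
proof -
  let ?r = "CARD('n) + CARD('p)"
  have le: "rank (pencil A B C D z) \<le> ?r" for z
    using rank_le_card_rows[of "pencil A B C D z"] by simp
  have "\<exists>z. rank (pencil A B C D z) = ?r"
  proof (rule ccontr)
    assume "\<not> ?thesis"
    then have "{z. rank (pencil A B C D z) \<noteq> ?r} = UNIV" by auto
    then show False
      using assms infinite_UNIV_char_0[where 'a = complex] by (simp add: right_invertible_def)
  qed
  then obtain z where z: "rank (pencil A B C D z) = ?r" by blast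
  have fin: "finite (range (\<lambda>z. rank (pencil A B C D z)))"
    using le by (auto intro: finite_subset[of _ "{..?r}"])
  show ?thesis
    unfolding normal_rank_def
  proof (rule Max_eqI[OF fin])
    show "?r \<in> range (\<lambda>z. rank (pencil A B C D z))"
      by (rule image_eqI[of _ _ z]) (simp_all only: z UNIV_I)
  qed (use le in blast)
qed

lemma finite_invariant_zeros: "right_invertible A B C D \<Longrightarrow> finite (invariant_zeros A B C D)"
  by (frule full_normal_rank) (auto simp: invariant_zeros_def right_invertible_def elim: finite_subset[rotated])

lemma pencil_surj:
  fixes A :: "real^'n^'n" and B :: "real^'m^'n" and C :: "real^'n^'p" and D :: "real^'m^'p"
  assumes "right_invertible A B C D" "z \<notin> invariant_zeros A B C D"
  shows "\<exists>\<xi>. pencil A B C D z *v \<xi> = \<eta>"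
proof -
  have "rank (pencil A B C D z) = CARD('n + 'p)"
    using assms rank_le_card_rows[of "pencil A B C D z"] full_normal_rank[OF assms(1)]
    by (simp add: invariant_zeros_def)
  then show ?thesis
    using full_row_rank_imp_surj by (metis surjD)
qed

subsection \<open>Output-nulling subspaces\<close>

lemma feedback_exists:
  fixes w :: "real^'n \<Rightarrow> real^'m"
  assumes "independent S"
  shows "\<exists>F :: real^'n^'m. \<forall>b\<in>S. F *v b = w b"
proof -
  obtain g where g: "linear g" "\<And>b. b \<in> S \<Longrightarrow> g b = w b"
    using linear_independent_extend[OF assms, of w] by blast
  then show ?thesis
    by (intro exI[of _ "matrix g"]) (simp add: matrix_works)
qed

lemma friend_span:
  fixes S :: "(real^'n) set"
  assumes "\<And>v. v \<in> S \<Longrightarrow> (A + B ** F) *v v \<in> span S \<and> (C + D ** F) *v v = 0"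
  shows "friend A B C D (span S) F"
  unfolding friend_def
proof safe
  fix v assume "v \<in> span S"
  then show "(A + B ** F) *v v \<in> span S"
  proof (induction rule: span_induct_alt)
    case (step c x y)
    then show ?case using assms
      by (auto simp: matrix_vector_right_distrib matrix_vector_mult_scaleR intro!: span_add span_scale)
  qed (simp add: span_zero)
next
  fix v assume "v \<in> span S"
  then show "(C + D ** F) *v v = 0"
  proof (induction rule: span_induct_alt)
    case (step c x y)
    then show ?case using assms
      by (auto simp: matrix_vector_right_distrib matrix_vector_mult_scaleR)
  qed simp
qed

lemma matrix_vector_mult_minus: "M *v (- x) = - (M *v x)" for M :: "real^'n^'k"
  by (rule linear_neg) simp

lemma closed_loop_mult: "(A + B ** F) *v v = A *v v + B *v (F *v v)" for A :: "real^'n^'k"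
  by (simp add: matrix_vector_mult_add_rdistrib matrix_vector_mul_assoc)

text \<open>Inputs chosen on a basis extend linearly to a feedback, which eliminates
  \<open>F\<close>. In this pointwise form the property passes to sums of subspaces, although two
  friends need not be compatible.\<close>

lemma output_nulling_iff:
  "output_nulling A B C D V \<longleftrightarrow>
    subspace V \<and> (\<forall>v\<in>V. \<exists>w. A *v v + B *v w \<in> V \<and> C *v v + D *v w = 0)"
proof (intro iffI conjI)
  assume r: "subspace V \<and> (\<forall>v\<in>V. \<exists>w. A *v v + B *v w \<in> V \<and> C *v v + D *v w = 0)"
  obtain S where S: "S \<subseteq> V" "independent S" "span S = V"
    using r by (metis basis_exists span_eq_iff span_minimal subset_antisym)
  obtain w where w: "\<And>v. v \<in> V \<Longrightarrow> A *v v + B *v w v \<in> V \<and> C *v v + D *v w v = 0"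
    using r by metis
  obtain F :: "real^'a^'b" where "\<And>b. b \<in> S \<Longrightarrow> F *v b = w b"
    using feedback_exists[OF S(2)] by blast
  then have "friend A B C D (span S) F"
    using w S by (intro friend_span) (auto simp: closed_loop_mult)
  then show "output_nulling A B C D V"
    using r S by (auto simp: output_nulling_def)
qed (auto simp: output_nulling_def friend_def closed_loop_mult)

lemma output_nulling_sum:
  assumes "output_nulling A B C D V" "output_nulling A B C D W"
  shows "output_nulling A B C D {x + y |x y. x \<in> V \<and> y \<in> W}"
  unfolding output_nulling_iff
proof safe
  show "subspace {x + y |x y. x \<in> V \<and> y \<in> W}"
    using assms by (intro subspace_sums) (auto simp: output_nulling_def)
next
  fix x y assume "x \<in> V" "y \<in> W"
  then obtain u w where uw: "A *v x + B *v u \<in> V" "C *v x + D *v u = 0" "A *v y + B *v w \<in> W" "C *v y + D *v w = 0"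
    using assms by (meson output_nulling_iff)
  then show "\<exists>w. A *v (x + y) + B *v w \<in> {x + y |x y. x \<in> V \<and> y \<in> W} \<and> C *v (x + y) + D *v w = 0"
  proof (intro exI[of _ "u + w"] conjI)
    have "A *v (x + y) + B *v (u + w) = (A *v x + B *v u) + (A *v y + B *v w)"
      by (simp add: matrix_vector_right_distrib)
    then show "A *v (x + y) + B *v (u + w) \<in> {x + y |x y. x \<in> V \<and> y \<in> W}"
      using uw by blast
    have "C *v (x + y) + D *v (u + w) = (C *v x + D *v u) + (C *v y + D *v w)"
      by (simp add: matrix_vector_right_distrib)
    then show "C *v (x + y) + D *v (u + w) = 0" using uw by simp
  qed
qed

lemma V_star_eqI:
  assumes "output_nulling A B C D V" "\<And>W. output_nulling A B C D W \<Longrightarrow> W \<subseteq> V"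
  shows "V_star A B C D = V"
  unfolding V_star_def using assms by (intro Greatest_equality)

text \<open>\<open>GREATEST\<close> is meaningful only once a largest element is known to exist. The
  union of all output-nulling subspaces is one, because closure under sums makes it a
  subspace.\<close>

lemma V_star_greatest:
  "output_nulling A B C D (V_star A B C D)"
  "output_nulling A B C D W \<Longrightarrow> W \<subseteq> V_star A B C D"
proof -
  define V where "V = \<Union>{W. output_nulling A B C D W}"
  have zero: "output_nulling A B C D {0}"
    by (auto simp: output_nulling_iff subspace_def intro: exI[of _ 0])
  have mem: "x + y \<in> V" if xy: "x \<in> V" "y \<in> V" for x y
  proof -
    obtain W W' where "output_nulling A B C D W" "x \<in> W" "output_nulling A B C D W'" "y \<in> W'"
      using xy by (auto simp: V_def)
    then show ?thesis
      unfolding V_def using output_nulling_sum[of A B C D W W']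
      by (intro UnionI[of "{x + y |x y. x \<in> W \<and> y \<in> W'}"]) auto
  qed
  have "output_nulling A B C D V"
    unfolding output_nulling_iff
  proof (intro conjI ballI subspaceI)
    show "0 \<in> V" using zero by (auto simp: V_def)
    show "c *\<^sub>R x \<in> V" if "x \<in> V" for c x
      using that by (auto simp: V_def output_nulling_def subspace_scale)
    show "\<exists>w. A *v v + B *v w \<in> V \<and> C *v v + D *v w = 0" if "v \<in> V" for v
      using that unfolding V_def output_nulling_iff by blast
  qed (rule mem)
  moreover have "W \<subseteq> V" if "output_nulling A B C D W" for W
    using that by (auto simp: V_def)
  ultimately show "output_nulling A B C D (V_star A B C D)"
    "output_nulling A B C D W \<Longrightarrow> W \<subseteq> V_star A B C D"
    using V_star_eqI[of A B C D V] by auto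
qed

section \<open>Reachability subspace and modes of an arbitrary quadruple, for the full system and
  for one with a dropped output\<close>

locale quadruple =
  fixes A :: "real^'n^'n" and B :: "real^'m^'n" and C :: "real^'n^'p" and D :: "real^'m^'p"
begin

abbreviation "V \<equiv> V_star A B C D"
abbreviation "R \<equiv> R_star A B C D"

text \<open>The very friend that \<open>reachability_on\<close> chooses, so \<open>R\<close> unfolds
  to the least \<open>M0\<close>-invariant subspace containing the inputs that stay in
  \<open>V\<close>.\<close>

definition F0 :: "real^'n^'m" where "F0 = (SOME F. friend A B C D V F)"
definition M0 :: "real^'n^'n" where "M0 = A + B ** F0"

definition modes :: "real set \<Rightarrow> (real^'n) set" where
  "modes \<Lambda> = {v. \<exists>l w. l \<in> \<Lambda> \<and> A *v v + B *v w = l *\<^sub>R v \<and> C *v v + D *v w = 0}"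

lemma friend_F0: "friend A B C D V F0"
  unfolding F0_def using V_star_greatest(1)[of A B C D] by (rule_tac someI_ex) (simp add: output_nulling_def)

lemma subspace_V: "subspace V"
  using V_star_greatest(1)[of A B C D] by (simp add: output_nulling_def)

lemma M0_V: "v \<in> V \<Longrightarrow> M0 *v v \<in> V"
  using friend_F0 by (simp add: friend_def M0_def)

lemma output_F0: "v \<in> V \<Longrightarrow> C *v v + D *v (F0 *v v) = 0"
  using friend_F0 by (simp add: friend_def closed_loop_mult)

lemma M0_mult: "M0 *v v = A *v v + B *v (F0 *v v)"
  by (simp add: M0_def closed_loop_mult)

lemma R_alt: "R = \<Inter>{W. subspace W \<and> V \<inter> {B *v u | u. D *v u = 0} \<subseteq> W \<and> (\<forall>w\<in>W. M0 *v w \<in> W)}"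
  by (simp add: R_star_def reachability_on_def smallest_invariant_def M0_def F0_def)

lemma subspace_R: "subspace R"
  unfolding R_alt by (rule subspace_Inter) auto

lemma M0_R: "v \<in> R \<Longrightarrow> M0 *v v \<in> R"
  unfolding R_alt by blast

lemma input_in_R: "D *v u = 0 \<Longrightarrow> B *v u \<in> V \<Longrightarrow> B *v u \<in> R"
  unfolding R_alt by blast

lemma R_minimal:
  assumes "subspace W" "\<And>u. D *v u = 0 \<Longrightarrow> B *v u \<in> V \<Longrightarrow> B *v u \<in> W" "\<And>w. w \<in> W \<Longrightarrow> M0 *v w \<in> W"
  shows "R \<subseteq> W"
  unfolding R_alt using assms by blast

lemma R_le_V: "R \<subseteq> V"
  by (rule R_minimal) (auto simp: subspace_V M0_V)

text \<open>Two inputs that keep v in \<open>V\<close> with zero output differ by an element of the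
  kernel of \<open>D\<close> that \<open>B\<close> sends into \<open>V\<close>, hence into
  \<open>R\<close>. So every admissible action on \<open>V\<close> is \<open>M0\<close> modulo
  \<open>R\<close>.\<close>

lemma equal_mod_R:
  assumes "v \<in> V" "A *v v + B *v w \<in> V" "C *v v + D *v w = 0"
  shows "B *v (w - F0 *v v) \<in> R" "D *v (w - F0 *v v) = 0" "A *v v + B *v w = M0 *v v + B *v (w - F0 *v v)"
proof -
  show "D *v (w - F0 *v v) = 0"
    using output_F0[OF assms(1)] assms(3)
    by (metis add_diff_cancel_left matrix_vector_mult_diff_distrib diff_self)
  show eq: "A *v v + B *v w = M0 *v v + B *v (w - F0 *v v)"
    by (simp add: M0_mult matrix_vector_mult_diff_distrib)
  have "B *v (w - F0 *v v) = (A *v v + B *v w) - M0 *v v"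
    using eq by simp
  then have "B *v (w - F0 *v v) \<in> V"
    using assms(2) M0_V[OF assms(1)] subspace_V by (simp add: subspace_diff)
  with \<open>D *v (w - F0 *v v) = 0\<close> show "B *v (w - F0 *v v) \<in> R"
    by (rule input_in_R)
qed

lemma modes_le_V: "modes \<Lambda> \<subseteq> V"
proof
  fix v assume "v \<in> modes \<Lambda>"
  then obtain l w where lw: "A *v v + B *v w = l *\<^sub>R v" "C *v v + D *v w = 0"
    by (auto simp: modes_def)
  have "output_nulling A B C D (span {v})"
    unfolding output_nulling_iff
  proof safe
    fix x assume "x \<in> span {v}"
    then obtain k where k: "x = k *\<^sub>R v" by (auto simp: span_singleton)
    have "A *v x + B *v (k *\<^sub>R w) = k *\<^sub>R (l *\<^sub>R v)" "C *v x + D *v (k *\<^sub>R w) = 0"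
      using lw(2) by (simp_all add: k matrix_vector_mult_scaleR flip: lw(1) scaleR_add_right)
    then show "\<exists>w. A *v x + B *v w \<in> span {v} \<and> C *v x + D *v w = 0"
      by (metis span_base span_scale singletonI)
  qed
  then show "v \<in> V" using V_star_greatest(2) span_base by blast
qed

text \<open>
  By the resolvent identity the span of the vectors \<open>(\<lambda> - M0)\<inverse> (B u)\<close>, \<open>\<lambda> \<in> \<Lambda>\<close>, is mapped into
  itself by \<open>(\<mu> - M0)\<inverse>\<close> for a fresh \<open>\<mu> \<in> \<Lambda>\<close>, hence is invariant under \<open>M0\<close>.
\<close>

lemma R_le_span_feedback_modes:
  assumes "infinite \<Lambda>"
  shows "R \<subseteq> span {v \<in> R. \<exists>l u. l \<in> \<Lambda> \<and> M0 *v v + B *v u = l *\<^sub>R v \<and> D *v u = 0}" (is "_ \<subseteq> span ?G")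
proof -
  \<comment> \<open>A real \<mu> outside \<open>?E\<close> makes the map \<open>f\<close> below
    injective, hence a bijection of \<open>R\<close>.\<close>
  let ?E = "{l. of_real l \<in> spectrum M0}"
  have "finite (complex_of_real -` spectrum M0)"
    by (rule finite_vimageI[OF finite_spectrum]) (simp add: inj_on_def)
  then have inf: "infinite (\<Lambda> - ?E)"
    using assms by (simp add: vimage_def)
  define G where "G = {v \<in> R. \<exists>l u. l \<in> \<Lambda> - ?E \<and> M0 *v v + B *v u = l *\<^sub>R v \<and> D *v u = 0}"
  \<comment> \<open>A basis involves only finitely many eigenvalues; this is what leaves a fresh
    \<mu> in \<Lambda>.\<close>
  obtain S where S: "S \<subseteq> G" "independent S" "G \<subseteq> span S"
    using maximal_independent_subset by metis
  have "\<forall>v\<in>S. \<exists>l. \<exists>u. l \<in> \<Lambda> - ?E \<and> M0 *v v + B *v u = l *\<^sub>R v \<and> D *v u = 0"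
    using S by (auto simp: G_def)
  then obtain l where l: "\<And>v. v \<in> S \<Longrightarrow> \<exists>u. l v \<in> \<Lambda> - ?E \<and> M0 *v v + B *v u = l v *\<^sub>R v \<and> D *v u = 0"
    by metis
  have "\<not> \<Lambda> - ?E \<subseteq> l ` S"
    using inf finite_subset finiteI_independent[OF S(2)] by blast
  then obtain \<mu> where \<mu>: "\<mu> \<in> \<Lambda> - ?E" "\<mu> \<notin> l ` S" by blast
  define f where "f v = M0 *v v - \<mu> *\<^sub>R v" for v
  have f: "linear f"
    unfolding f_def by (intro linear_compose_sub linear_scale_self) simp
  have f0: "v = 0" if "f v = 0" for v
    using that real_eigenvalue_in_spectrum[of M0 v \<mu>] \<mu>(1) by (auto simp: f_def)
  have fR: "f ` R = R"
    using M0_R subspace_R f0 by (intro linear_image_eq_of_injective f)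
      (auto simp: f_def subspace_diff subspace_scale)
  have G_img: "B *v u \<in> f ` G" if "D *v u = 0" "B *v u \<in> R" for u
  proof -
    have "B *v u \<in> f ` R" unfolding fR by (rule that(2))
    then obtain c where c: "c \<in> R" "B *v u = f c" by auto
    then have "M0 *v c + B *v (- u) = \<mu> *\<^sub>R c"
      by (simp add: f_def matrix_vector_mult_minus)
    then have "c \<in> G"
      using c(1) \<mu>(1) that(1) by (auto simp: G_def matrix_vector_mult_minus intro!: exI[of _ \<mu>] exI[of _ "- u"])
    then show ?thesis using c by blast
  qed
  have "S \<subseteq> f ` span G"
  proof
    fix b assume b: "b \<in> S"
    then obtain u where u: "M0 *v b + B *v u = l b *\<^sub>R b" "D *v u = 0"
      using l by blast
    have bR: "b \<in> R" using b S by (auto simp: G_def)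
    have "B *v u = l b *\<^sub>R b - M0 *v b" using u(1) by (simp add: algebra_simps)
    then have "B *v u \<in> R"
      using bR M0_R subspace_R by (simp add: subspace_diff subspace_scale)
    then obtain c where c: "c \<in> G" "B *v u = f c" using G_img u(2) by blast
    \<comment> \<open>The resolvent identity: \<open>f b\<close> is (l b - \<mu>) times
      \<open>b\<close> minus \<open>B *v u\<close>, and \<open>f c\<close> is \<open>B *v u\<close>,
      so \<open>f\<close> maps \<open>b + c\<close> to a nonzero multiple of
      \<open>b\<close>.\<close>
    have ne: "l b - \<mu> \<noteq> 0" using b \<mu> by auto
    have "f (b + c) = (l b - \<mu>) *\<^sub>R b"
      using u(1) c(2) by (simp add: f_def matrix_vector_right_distrib algebra_simps)
    then have "b = f ((1 / (l b - \<mu>)) *\<^sub>R (b + c))"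
      using ne by (simp add: linear_scale[OF f])
    moreover have "(1 / (l b - \<mu>)) *\<^sub>R (b + c) \<in> span G"
      using b S c by (intro span_scale span_add span_base) auto
    ultimately show "b \<in> f ` span G" by blast
  qed
  then have "span S \<subseteq> f ` span G"
    by (intro span_minimal linear_subspace_image f) auto
  moreover have "span G = span S"
    using S by (simp add: span_minimal span_mono subset_antisym)
  ultimately have img: "f ` span G = span G"
    by (metis dim_image_le f linear_subspace_image subspace_dim_equal subspace_span)
  have "R \<subseteq> span G"
  proof (rule R_minimal)
    fix u assume "D *v u = 0" "B *v u \<in> V"
    then have "B *v u \<in> f ` G" by (intro G_img input_in_R)
    then have "B *v u \<in> f ` span G" by (auto intro: span_base)
    then show "B *v u \<in> span G" unfolding img .
  next
    fix w assume w: "w \<in> span G"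
    then have "f w \<in> f ` span G" by (rule imageI)
    then have "f w \<in> span G" unfolding img .
    then have "f w + \<mu> *\<^sub>R w \<in> span G" using w by (intro span_add span_scale)
    then show "M0 *v w \<in> span G" by (simp add: f_def)
  qed simp
  also have "span G \<subseteq> span ?G"
    by (intro span_mono) (auto simp: G_def)
  finally show ?thesis .
qed

lemma R_le_span_modes:
  assumes "infinite \<Lambda>" shows "R \<subseteq> span (modes \<Lambda>)"
proof -
  have "{v \<in> R. \<exists>l u. l \<in> \<Lambda> \<and> M0 *v v + B *v u = l *\<^sub>R v \<and> D *v u = 0} \<subseteq> modes \<Lambda>"
  proof safe
    fix v l u assume v: "v \<in> R" and *: "l \<in> \<Lambda>" "M0 *v v + B *v u = l *\<^sub>R v" "D *v u = 0"
    have "A *v v + B *v (F0 *v v + u) = l *\<^sub>R v" "C *v v + D *v (F0 *v v + u) = 0"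
      using * output_F0[of v] v R_le_V
      by (auto simp: M0_mult matrix_vector_right_distrib add.assoc)
    then show "v \<in> modes \<Lambda>"
      using * by (auto simp: modes_def)
  qed
  then show ?thesis
    using R_le_span_feedback_modes[OF assms] span_mono by blast
qed

text \<open>A Hautus test for \<open>R\<close>: with inputs from the kernel of \<open>D\<close> the
  shifted map covers \<open>R\<close> even when z is an eigenvalue of \<open>M0\<close>. Since
  \<open>R\<close> is spanned by modes over any infinite set of eigenvalues, those with l = z can be
  avoided; on the others one divides by l - z. Excluding the single real number Re z
  suffices.\<close>

lemma pole_shift_R:
  assumes "r \<in> complexify R"
  shows "\<exists>\<rho> u. \<rho> \<in> complexify R \<and> complex_matrix D *v u = 0 \<and> shifted M0 z \<rho> + complex_matrix B *v u = r"
proof -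
  let ?G = "{v \<in> R. \<exists>l u. l \<in> - {Re z} \<and> M0 *v v + B *v u = l *\<^sub>R v \<and> D *v u = 0}"
  have inf: "infinite (- {Re z})"
    using infinite_UNIV_char_0[where 'a = real] by (metis Compl_eq_Diff_UNIV finite.emptyI finite_Diff2 finite_insert)
  have "r \<in> complexify (span ?G)"
    using assms complexify_mono[OF R_le_span_feedback_modes[OF inf]] by blast
  then show ?thesis
  proof (induction rule: complexify_span_induct)
    case (base v)
    then obtain l u where v: "v \<in> R" and l: "l \<noteq> Re z" "M0 *v v + B *v u = l *\<^sub>R v" "D *v u = 0" by auto
    define c where "c = 1 / (of_real l - z)"
    have c: "c * (of_real l - z) = 1" using l by (auto simp: c_def)
    have Mv: "M0 *v v = l *\<^sub>R v - B *v u" using l(2) by (simp add: algebra_simps)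
    have "shifted M0 z (c *s of_real_vec v) + complex_matrix B *v (c *s of_real_vec u) = 
        c *s (shifted M0 z (of_real_vec v) + complex_matrix B *v of_real_vec u)"
      by (simp only: shifted_linear(3)) (simp only: vec.scale vec.scale_right_distrib)
    also have "shifted M0 z (of_real_vec v) + complex_matrix B *v of_real_vec u = (of_real l - z) *s of_real_vec v"
      by (simp add: of_real_vec_simps Mv vec.scale_left_diff_distrib)
    also have "c *s \<dots> = of_real_vec v"
      by (simp only: vec.scale_scale c vec.scale_one)
    finally show ?case
      using v l(3) complexify_smult[OF subspace_R, of "of_real_vec v"] subspace_R
      by (intro exI[of _ "c *s of_real_vec v"] exI[of _ "c *s of_real_vec u"])
        (simp add: vec.scale of_real_vec_simps)
  next
    case (add v w)
    then obtain \<rho> u \<rho>' u' where "\<rho> \<in> complexify R" "complex_matrix D *v u = 0" "shifted M0 z \<rho> + complex_matrix B *v u = v"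
      "\<rho>' \<in> complexify R" "complex_matrix D *v u' = 0" "shifted M0 z \<rho>' + complex_matrix B *v u' = w" by blast
    then show ?case
      using subspace_add[OF subspace_complexify[OF subspace_R]]
      by (intro exI[of _ "\<rho> + \<rho>'"] exI[of _ "u + u'"])
        (auto simp only: shifted_linear(1) matrix_vector_right_distrib add_0_left algebra_simps)
  next
    case (smult c v)
    then obtain \<rho> u where "\<rho> \<in> complexify R" "complex_matrix D *v u = 0" "shifted M0 z \<rho> + complex_matrix B *v u = v"
      by blast
    then show ?case
      using complexify_smult[OF subspace_R]
      by (intro exI[of _ "c *s \<rho>"] exI[of _ "c *s u"])
        (simp only: shifted_linear(3), auto simp only: vec.scale vec.scale_right_distrib vec.scale_zero_right)
  next
    case zero
    show ?case
      using subspace_0[OF subspace_complexify[OF subspace_R]]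
      by (intro exI[of _ 0]) (simp add: matrix_vector_mult_0_right)
  qed
qed

end

section \<open>States of kernel vectors of the pencil, modulo the reachability subspace\<close>

context quadruple
begin

text \<open>The real and imaginary parts of the state may fail to be modes one by one, but together
  they span an output-nulling subspace.\<close>

lemma kernel_in_V:
  assumes "pencil A B C D z *v \<xi> = 0"
  shows "upper \<xi> \<in> complexify V"
proof -
  define a b where "a = re_vec (upper \<xi>)" and "b = im_vec (upper \<xi>)"
  define wa wb where "wa = re_vec (lower \<xi>)" and "wb = im_vec (lower \<xi>)"
  have eq: "A *v a + B *v wa = Re z *\<^sub>R a - Im z *\<^sub>R b" "A *v b + B *v wb = Re z *\<^sub>R b + Im z *\<^sub>R a"
     "C *v a + D *v wa = 0" "C *v b + D *v wb = 0"
    using assms[unfolded pencil_mult_eq_0_iff, unfolded complex_vec_eq_iff]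
    by (simp_all add: a_def b_def wa_def wb_def)
  have "output_nulling A B C D (span {a, b})"
    unfolding output_nulling_iff
  proof (intro conjI ballI subspace_span)
    fix v assume "v \<in> span {a, b}"
    then obtain k l where v: "v = k *\<^sub>R a + l *\<^sub>R b"
      by (auto simp: span_insert span_singleton) (metis add.commute diff_add_cancel)
    have "A *v v + B *v (k *\<^sub>R wa + l *\<^sub>R wb) = k *\<^sub>R (A *v a + B *v wa) + l *\<^sub>R (A *v b + B *v wb)"
      by (simp add: v matrix_vector_right_distrib matrix_vector_mult_scaleR scaleR_add_right)
    then have "A *v v + B *v (k *\<^sub>R wa + l *\<^sub>R wb) \<in> span {a, b}"
      unfolding eq by (simp add: span_add span_diff span_scale span_base)
    moreover have "C *v v + D *v (k *\<^sub>R wa + l *\<^sub>R wb) = k *\<^sub>R (C *v a + D *v wa) + l *\<^sub>R (C *v b + D *v wb)"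
      by (simp add: v matrix_vector_right_distrib matrix_vector_mult_scaleR scaleR_add_right)
    ultimately show "\<exists>w. A *v v + B *v w \<in> span {a, b} \<and> C *v v + D *v w = 0"
      using eq by auto
  qed
  then have "span {a, b} \<subseteq> V" by (rule V_star_greatest)
  then show ?thesis
    using span_base[of _ "{a, b}"] by (auto simp: complexify_def a_def b_def)
qed

lemma shifted_M0: "shifted M0 z x = complex_matrix A *v x + complex_matrix B *v (complex_matrix F0 *v x) - z *s x"
  by (simp add: M0_def complex_matrix_closed_loop)

lemma output_F0_complex:
  "x \<in> complexify V \<Longrightarrow> complex_matrix C *v x + complex_matrix D *v (complex_matrix F0 *v x) = 0"
  using output_F0 by (simp add: complex_vec_eq_iff complexify_def)

text \<open>The state is an eigenvector of \<open>M0\<close> modulo \<open>R\<close>: the shift by z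
  leaves only a term \<open>B u\<close> with \<open>D u = 0\<close>, which lies in \<open>V\<close>
  and hence in \<open>R\<close>.\<close>

lemma kernel_state_feedback:
  assumes "pencil A B C D z *v \<xi> = 0"
  shows "shifted M0 z (upper \<xi>) \<in> complexify R"
proof -
  have V: "upper \<xi> \<in> complexify V" using kernel_in_V[OF assms] .
  define u where "u = lower \<xi> - complex_matrix F0 *v upper \<xi>"
  have eq: "shifted M0 z (upper \<xi>) = - (complex_matrix B *v u)"
    using assms by (simp add: shifted_M0 pencil_mult_eq_0_iff u_def vec.diff algebra_simps)
  have "complex_matrix D *v u = 0"
    using assms output_F0_complex[OF V] unfolding pencil_mult_eq_0_iff u_def vec.diff
    by (metis add_diff_cancel_left diff_self)
  moreover have "complex_matrix B *v u \<in> complexify V"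
  proof -
    have "shifted M0 z (upper \<xi>) \<in> complexify V"
      using V M0_V subspace_V by (intro shifted_closed)
    then show ?thesis
      using subspace_neg[OF subspace_complexify[OF subspace_V]] eq by (metis minus_minus)
  qed
  ultimately have "complex_matrix B *v u \<in> complexify R"
    using input_in_R by (auto simp: complexify_def complex_vec_eq_iff)
  then show ?thesis
    using subspace_neg[OF subspace_complexify[OF subspace_R]] eq by metis
qed

text \<open>Off the spectrum the shifted \<open>M0\<close> is injective and maps \<open>R\<close>
  onto itself, so a vector that it sends into \<open>R\<close> was already there.\<close>

lemma generic_kernel_in_R:
  assumes "pencil A B C D \<mu> *v \<xi> = 0" "\<mu> \<notin> spectrum M0"
  shows "upper \<xi> \<in> complexify R"
proof -
  have inj: "x = 0" if "shifted M0 \<mu> x = 0" for x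
    using that assms(2) by (auto simp: spectrum_on_alt complexify_def)
  have "shifted M0 \<mu> ` complexify R = complexify R"
    using inj M0_R subspace_R
    by (intro linear_image_eq_of_injective linear_shifted subspace_complexify shifted_closed)
  then have "shifted M0 \<mu> (upper \<xi>) \<in> shifted M0 \<mu> ` complexify R"
    using kernel_state_feedback[OF assms(1)] by simp
  then obtain x where "x \<in> complexify R" "shifted M0 \<mu> (upper \<xi>) = shifted M0 \<mu> x"
    by (rule imageE)
  then have "shifted M0 \<mu> (upper \<xi> - x) = 0" by (simp only: shifted_linear(2)) simp
  then show ?thesis using inj \<open>x \<in> _\<close> by fastforce
qed

text \<open>The nearby kernel vectors are a hypothesis because they have two sources: the pencil
  where it is onto, and at a zero its quotient by s - z.\<close>

lemma limit_in_R:
  assumes "\<delta> > 0"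
    and "\<And>t. 0 < t \<Longrightarrow> t < \<delta> \<Longrightarrow> \<exists>\<xi>. pencil A B C D (z + of_real t) *v \<xi> = 0 \<and> norm (\<xi> - \<eta>) \<le> t * c"
  shows "upper \<eta> \<in> complexify R"
proof -
  have "finite ((\<lambda>t. z + of_real t) -` spectrum M0)"
    by (rule finite_vimageI[OF finite_spectrum]) (simp add: inj_on_def)
  then have fin: "finite {t. z + of_real t \<in> spectrum M0}" by (simp add: vimage_def)
  have "upper \<eta> \<in> closure (complexify R)"
    unfolding closure_approachable
  proof (intro allI impI)
    fix e :: real assume e: "e > 0"
    define d where "d = min \<delta> (e / (\<bar>c\<bar> + 1))"
    have d: "d > 0" using e assms(1) by (simp add: d_def)
    have "infinite {0<..<d}" using d by simp
    then have "\<not> {0<..<d} \<subseteq> {t. z + of_real t \<in> spectrum M0}" using fin finite_subset by blast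
    then obtain t where "t \<in> {0<..<d}" "t \<notin> {t. z + of_real t \<in> spectrum M0}" by blast
    then have t: "0 < t" "t < d" "z + of_real t \<notin> spectrum M0" by simp_all
    then obtain \<xi> where \<xi>: "pencil A B C D (z + of_real t) *v \<xi> = 0" "norm (\<xi> - \<eta>) \<le> t * c"
      using assms(2)[of t] by (auto simp: d_def)
    have "norm (upper \<xi> - upper \<eta>) \<le> t * c"
      using norm_upper_le[of "\<xi> - \<eta>"] \<xi>(2) by simp
    also have "\<dots> \<le> t * (\<bar>c\<bar> + 1)" using t by (intro mult_left_mono) auto
    also have "\<dots> < e" using t by (simp add: d_def pos_less_divide_eq)
    finally show "\<exists>y\<in>complexify R. dist y (upper \<eta>) < e"
      using generic_kernel_in_R[OF \<xi>(1) t(3)] by (auto simp: dist_norm)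
  qed
  then show ?thesis
    using closed_complexify[OF subspace_R] by simp
qed

lemma linear_upper_stack: "linear (\<lambda>\<xi> :: complex^('n + 'm). stack (upper \<xi>) (0 :: complex^'p))"
  by (rule linearI) (simp_all add: stack_eq_iff)

text \<open>Only targets with zero output part have to be reached, since the perturbation of the
  pencil changes the state rows alone. This matters for a dropped output, whose zero row keeps the
  pencil from being onto.\<close>

lemma kernel_in_R:
  assumes "\<And>x. \<exists>\<xi>. pencil A B C D z *v \<xi> = stack x 0" and "pencil A B C D z *v \<eta> = 0"
  shows "upper \<eta> \<in> complexify R"
proof -
  have "range (\<lambda>\<xi> :: complex^('n + 'm). stack (upper \<xi>) (0 :: complex^'p)) \<subseteq> range ((*v) (pencil A B C D z))"
    using assms(1) by (metis image_subsetI rangeI)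
  then obtain \<delta> c where "\<delta> > 0" and *: "\<And>t. \<bar>t\<bar> < \<delta> \<Longrightarrow>
      \<exists>\<xi>. pencil A B C D z *v \<xi> = t *\<^sub>R stack (upper \<xi>) 0 \<and> norm (\<xi> - \<eta>) \<le> \<bar>t\<bar> * c"
    using kernel_perturbation[OF linear_matrix_vector_mult linear_upper_stack _ assms(2)] by metis
  show ?thesis
  proof (rule limit_in_R[OF \<open>\<delta> > 0\<close>])
    fix t assume "0 < t" "t < \<delta>"
    then obtain \<xi> where "pencil A B C D z *v \<xi> = t *\<^sub>R stack (upper \<xi>) 0" "norm (\<xi> - \<eta>) \<le> t * c"
      using *[of t] by auto
    then show "\<exists>\<xi>. pencil A B C D (z + of_real t) *v \<xi> = 0 \<and> norm (\<xi> - \<eta>) \<le> t * c"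
      by (intro exI[of _ \<xi>]) (simp add: pencil_add_mult)
  qed
qed

text \<open>Converse to \<open>kernel_state_feedback\<close>: by \<open>pole_shift_R\<close> an
  eigenvector modulo \<open>R\<close> is corrected by an element of \<open>R\<close> to the state of
  an exact kernel vector.\<close>

lemma kernel_from_R:
  assumes "x \<in> complexify V" "shifted M0 z x \<in> complexify R"
  obtains \<rho> \<xi> where "\<rho> \<in> complexify R" "upper \<xi> = x - \<rho>" "pencil A B C D z *v \<xi> = 0"
proof -
  obtain \<rho> u where u: "\<rho> \<in> complexify R" "complex_matrix D *v u = 0" "shifted M0 z \<rho> + complex_matrix B *v u = shifted M0 z x"
    using pole_shift_R[OF assms(2)] by blast
  let ?y = "x - \<rho>"
  have V: "?y \<in> complexify V"
    using assms(1) u(1) complexify_mono[OF R_le_V] subspace_diff[OF subspace_complexify[OF subspace_V]] by blast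
  have "shifted M0 z ?y = complex_matrix B *v u"
    by (simp only: shifted_linear(2) u(3)[symmetric]) simp
  then have "pencil A B C D z *v stack ?y (complex_matrix F0 *v ?y - u) = 0"
    using output_F0_complex[OF V] u(2) unfolding pencil_mult_eq_0_iff stack_simps shifted_M0 vec.diff[of _ _ u]
    by (simp add: algebra_simps)
  then show ?thesis using that u(1) by (metis stack_simps(1))
qed

lemma no_mode_at_nonzero:
  assumes "\<And>x. \<exists>\<xi>. pencil A B C D z *v \<xi> = stack x 0"
    and "x \<in> complexify V" "shifted M0 z x \<in> complexify R"
  shows "x \<in> complexify R"
proof -
  obtain \<rho> \<xi> where *: "\<rho> \<in> complexify R" "upper \<xi> = x - \<rho>" "pencil A B C D z *v \<xi> = 0"
    using kernel_from_R[OF assms(2,3)] .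
  then have "x - \<rho> \<in> complexify R" using kernel_in_R[OF assms(1)] by metis
  then show ?thesis
    using *(1) subspace_add[OF subspace_complexify[OF subspace_R]] by fastforce
qed

end

subsection \<open>Zeros of equal algebraic and geometric multiplicity\<close>

text \<open>
  The rows in \<open>J\<close> of \<open>L\<close> are left null vectors at \<open>z\<close>.  In those rows \<open>L\<close> times the pencil is
  divisible by \<open>s - z\<close>; \<open>reduced_pencil\<close> is the quotient.
\<close>

definition reduced_pencil where
  "reduced_pencil L J A B C D z s =
     (\<chi> j. if j \<in> J then (\<chi> c. case c of Inl i \<Rightarrow> - L $ j $ Inl i | Inr k \<Rightarrow> 0) else (L ** pencil A B C D s) $ j)"

lemma reduced_pencil_mult:
  fixes \<xi> :: "complex^('n::finite + 'm::finite)" and L :: "complex^('n + 'p::finite)^('n + 'p)"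
  shows "(reduced_pencil L J A B C D z s *v \<xi>) $ j =
     (if j \<in> J then - (L *v stack (upper \<xi>) 0) $ j else (L *v (pencil A B C D s *v \<xi>)) $ j)"
proof (cases "j \<in> J")
  case True
  have "(\<Sum>c\<in>UNIV. f c) = (\<Sum>i\<in>UNIV. f (Inl i)) + (\<Sum>k\<in>UNIV. f (Inr k))" for f :: "'n + 'm \<Rightarrow> complex"
    by (subst UNIV_Plus_UNIV[symmetric], subst sum.Plus) auto
  moreover have "(\<Sum>c\<in>UNIV. f c) = (\<Sum>i\<in>UNIV. f (Inl i)) + (\<Sum>k\<in>UNIV. f (Inr k))" for f :: "'n + 'p \<Rightarrow> complex"
    by (subst UNIV_Plus_UNIV[symmetric], subst sum.Plus) auto
  ultimately show ?thesis
    using True by (simp add: reduced_pencil_def matrix_vector_mult_def stack_def upper_def sum_negf)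
next
  case False
  then have "(reduced_pencil L J A B C D z s *v \<xi>) $ j = ((L ** pencil A B C D s) *v \<xi>) $ j"
    by (simp add: reduced_pencil_def matrix_vector_mult_def)
  then show ?thesis
    using False by (simp add: matrix_vector_mul_assoc)
qed

context quadruple
begin

text \<open>The vectors \<eta>, \<xi> form a chain of length two. In the rows of \<open>J\<close>
  the chain equation says that \<open>L\<close> times the state of \<eta> vanishes, so \<eta> is in
  the kernel of the reduced pencil. That pencil is onto at z, so \<eta> deforms into its kernels at
  nearby points, and these lie in the kernels of the original pencil.\<close>

lemma reduced_kernel_in_R:
  fixes L :: "complex^('n + 'p)^('n + 'p)"
  assumes L: "invertible L" and J: "\<And>j. j \<in> J \<Longrightarrow> (L ** pencil A B C D z) $ j = 0"
    and surj: "surj ((*v) (reduced_pencil L J A B C D z z))"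
    and \<eta>: "pencil A B C D z *v \<eta> = 0" and \<xi>: "pencil A B C D z *v \<xi> = stack (upper \<eta>) 0"
  shows "upper \<eta> \<in> complexify R"
proof -
  \<comment> \<open>The reduced pencil at z + t is the one at z minus t times \<open>e\<close>; its
    rows in \<open>J\<close> are constant in s.\<close>
  define e where "e \<zeta> = (\<chi> j. if j \<in> J then 0 else (L *v stack (upper \<zeta>) 0) $ j)" for \<zeta> :: "complex^('n + 'm)"
  have Lin: "linear (\<lambda>\<zeta> :: complex^('n + 'm). L *v stack (upper \<zeta>) (0 :: complex^'p))"
    using linear_compose[OF linear_upper_stack linear_matrix_vector_mult[of L]] by (simp add: o_def)
  have e: "linear e"
    by (rule linearI) (simp_all add: e_def vec_eq_iff linear_add[OF Lin, simplified] linear_scale[OF Lin, simplified])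
  have LJ: "(L *v (pencil A B C D z *v \<zeta>)) $ j = 0" if "j \<in> J" for j \<zeta>
  proof -
    have "((L ** pencil A B C D z) *v \<zeta>) $ j = 0"
      using J[OF that] by (simp add: matrix_vector_mult_def)
    then show ?thesis by (simp add: matrix_vector_mul_assoc)
  qed
  have "reduced_pencil L J A B C D z z *v \<eta> = 0"
    unfolding vec_eq_iff reduced_pencil_mult
    using LJ[of _ \<xi>] by (simp add: \<eta> \<xi>)
  then obtain \<delta> c where "\<delta> > 0" and *: "\<And>t. \<bar>t\<bar> < \<delta> \<Longrightarrow>
      \<exists>\<zeta>. reduced_pencil L J A B C D z z *v \<zeta> = t *\<^sub>R e \<zeta> \<and> norm (\<zeta> - \<eta>) \<le> \<bar>t\<bar> * c"
    using kernel_perturbation[OF linear_matrix_vector_mult e _ , of "reduced_pencil L J A B C D z z" \<eta>] surj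
    by (metis top_greatest)
  show ?thesis
  proof (rule limit_in_R[OF \<open>\<delta> > 0\<close>])
    fix t assume t: "0 < t" "t < \<delta>"
    then obtain \<zeta> where \<zeta>: "reduced_pencil L J A B C D z z *v \<zeta> = t *\<^sub>R e \<zeta>" "norm (\<zeta> - \<eta>) \<le> t * c"
      using *[of t] by auto
    have "(L *v (pencil A B C D (z + of_real t) *v \<zeta>)) $ j = 0" for j
    proof -
      have "L *v (pencil A B C D (z + of_real t) *v \<zeta>) =
          L *v (pencil A B C D z *v \<zeta>) - t *\<^sub>R (L *v stack (upper \<zeta>) 0)"
        by (simp add: pencil_add_mult vec.diff linear_scale[OF linear_matrix_vector_mult])
      moreover have "(reduced_pencil L J A B C D z z *v \<zeta>) $ j = t *\<^sub>R e \<zeta> $ j"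
        using \<zeta>(1) by simp
      ultimately show ?thesis
        using t LJ[of j \<zeta>] by (cases "j \<in> J") (auto simp: reduced_pencil_mult e_def)
    qed
    then have "L *v (pencil A B C D (z + of_real t) *v \<zeta>) = 0" by (simp add: vec_eq_iff)
    then have "pencil A B C D (z + of_real t) *v \<zeta> = 0"
      using L by (metis invertible_def matrix_left_invertible_ker)
    then show "\<exists>\<xi>. pencil A B C D (z + of_real t) *v \<xi> = 0 \<and> norm (\<xi> - \<eta>) \<le> t * c"
      using \<zeta>(2) by blast
  qed
qed

end

section \<open>Full-order minors and the multiplicity of a zero\<close>

lemma minor_eq_det:
  fixes M :: "'a::comm_ring_1^'c^'r"
  assumes f: "bij_betw f {..<CARD('r)} (UNIV :: 'r set)"
  shows "(\<Sum>\<pi> | \<pi> permutes {..<CARD('r)}. of_int (sign \<pi>) * (\<Prod>a<CARD('r). M $ f a $ g (\<pi> a))) =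
    det (\<chi> i j. M $ i $ g (inv_into {..<CARD('r)} f j))"
proof -
  let ?K = "{..<CARD('r)}"
  have inj: "inj_on f ?K" using f by (rule bij_betw_imp_inj_on)
  have "det (\<chi> i j. M $ i $ g (inv_into ?K f j)) =
      (\<Sum>\<pi> | \<pi> permutes ?K. of_int (sign (map_permutation ?K f \<pi>)) *
        (\<Prod>i\<in>UNIV. M $ i $ g (inv_into ?K f (map_permutation ?K f \<pi> i))))"
    unfolding det_def using bij_betw_permutations[OF f]
    by (subst sum.reindex_bij_betw[symmetric])
      (auto simp: map_permutation_def restrict_id_def o_def bij_betw_imp_surj_on[OF f])
  also have "\<dots> = (\<Sum>\<pi> | \<pi> permutes ?K. of_int (sign \<pi>) * (\<Prod>a<CARD('r). M $ f a $ g (\<pi> a)))"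
  proof (intro sum.cong refl arg_cong2[of _ _ _ _ "(*)"])
    fix \<pi> assume "\<pi> \<in> {\<pi>. \<pi> permutes ?K}"
    then have \<pi>: "\<pi> permutes ?K" by simp
    show "of_int (sign (map_permutation ?K f \<pi>)) = (of_int (sign \<pi>) :: 'a)"
      using sign_map_permutation[OF inj \<pi>] by simp
    have "\<pi> a \<in> ?K" if "a \<in> ?K" for a
      using permutes_in_image[OF \<pi>] that by blast
    then show "(\<Prod>i\<in>UNIV. M $ i $ g (inv_into ?K f (map_permutation ?K f \<pi> i))) = (\<Prod>a<CARD('r). M $ f a $ g (\<pi> a))"
      by (subst prod.reindex_bij_betw[OF f, symmetric], intro prod.cong refl)
        (simp add: map_permutation_apply[OF inj] inv_into_f_f[OF inj])
  qed
  finally show ?thesis ..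
qed

text \<open>At full order the row selection is a bijection onto the row type. Conjugation by it
  preserves signs of permutations, so it can be absorbed into the column selection.\<close>

lemma in_minors_iff_det:
  fixes M :: "'a::comm_ring_1^'c^'r"
  shows "p \<in> minors CARD('r) M \<longleftrightarrow> (\<exists>h :: 'r \<Rightarrow> 'c. inj h \<and> p = det (\<chi> i j. M $ i $ h j))"
proof
  let ?K = "{..<CARD('r)}"
  assume "p \<in> minors CARD('r) M"
  then obtain f :: "nat \<Rightarrow> 'r" and g :: "nat \<Rightarrow> 'c" where inj: "inj_on f ?K" "inj_on g ?K"
    and p: "p = (\<Sum>\<pi> | \<pi> permutes ?K. of_int (sign \<pi>) * (\<Prod>a<CARD('r). M $ f a $ g (\<pi> a)))"
    by (auto simp: minors_def)
  have "f ` ?K = UNIV"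
    using card_image[OF inj(1)] by (intro card_eq_UNIV_imp_eq_UNIV) auto
  then have f: "bij_betw f ?K UNIV" using inj by (simp add: bij_betw_def)
  have "inj (\<lambda>j. g (inv_into ?K f j))"
    using comp_inj_on[OF bij_betw_imp_inj_on[OF bij_betw_inv_into[OF f]], of g]
      bij_betw_imp_surj_on[OF bij_betw_inv_into[OF f]] inj(2) by (simp add: o_def)
  then show "\<exists>h :: 'r \<Rightarrow> 'c. inj h \<and> p = det (\<chi> i j. M $ i $ h j)"
    using minor_eq_det[OF f, of M g] p by (intro exI[of _ "\<lambda>j. g (inv_into ?K f j)"]) simp
next
  let ?K = "{..<CARD('r)}"
  assume "\<exists>h :: 'r \<Rightarrow> 'c. inj h \<and> p = det (\<chi> i j. M $ i $ h j)"
  then obtain h :: "'r \<Rightarrow> 'c" where h: "inj h" "p = det (\<chi> i j. M $ i $ h j)" by blast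
  obtain f :: "nat \<Rightarrow> 'r" where f: "bij_betw f ?K UNIV"
    using ex_bij_betw_nat_finite[of "UNIV :: 'r set"] by (auto simp: atLeast0LessThan)
  have inj: "inj_on f ?K" using f by (rule bij_betw_imp_inj_on)
  have "f (inv_into ?K f j) = j" for j
    using f by (metis UNIV_I bij_betw_inv_into_right)
  then have "p = (\<Sum>\<pi> | \<pi> permutes ?K. of_int (sign \<pi>) * (\<Prod>a<CARD('r). M $ f a $ (h \<circ> f) (\<pi> a)))"
    unfolding minor_eq_det[OF f] by (simp add: h)
  moreover have "inj_on (h \<circ> f) ?K"
    using inj h(1) by (metis comp_inj_on inj_on_subset subset_UNIV)
  ultimately show "p \<in> minors CARD('r) M"
    unfolding minors_def using inj by blast
qed

lemma poly_det: "poly (det M) x = det (\<chi> i j. poly (M $ i $ j) x)" for M :: "complex poly^'r^'r"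
  by (simp add: det_def poly_sum poly_prod)

lemma nonzero_minor_exists:
  fixes M :: "complex^'c^'r"
  assumes "surj ((*v) M)"
  shows "\<exists>h :: 'r \<Rightarrow> 'c. inj h \<and> det (\<chi> i j. M $ i $ h j) \<noteq> 0"
proof -
  have span: "vec.span (columns M) = UNIV"
    by (rule iffD1[OF matrix_right_invertible_span_columns iffD2[OF matrix_right_invertible_surjective assms]])
  obtain S where S: "S \<subseteq> columns M" "vec.independent S" "columns M \<subseteq> vec.span S" "card S = vec.dim (columns M)"
    using vec.basis_exists by blast
  have spanS: "vec.span S = UNIV"
    using S span by (metis top.extremum_uniqueI vec.span_minimal vec.subspace_span)
  have "card S = CARD('r)"
    using S(4) span by (metis vec.dim_UNIV vec.dim_span vec_dim_card)
  then obtain b where b: "bij_betw b (UNIV :: 'r set) S"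
    using finite_same_card_bij[of "UNIV :: 'r set" S] vec.finiteI_independent[OF S(2)] by auto
  have "\<exists>k. column k M = b c" for c
  proof -
    have "b c \<in> columns M" using b S(1) by (auto simp: bij_betw_def)
    then obtain k where "b c = column k M" unfolding columns_def by blast
    then show ?thesis by (intro exI[of _ k]) simp
  qed
  then obtain h where h: "\<And>c. column (h c) M = b c" by metis
  have "inj h"
    using h b by (metis bij_betw_imp_inj_on injD injI)
  let ?N = "\<chi> i j. M $ i $ h j"
  have "column c ?N = b c" for c
    using h[of c] by (simp add: column_def)
  then have "columns ?N = S"
    using b by (auto simp: columns_def bij_betw_def)
  then have "invertible ?N"
    using spanS by (simp add: invertible_right_inverse matrix_right_invertible_span_columns)
  then show ?thesis
    using \<open>inj h\<close> invertible_det_nz by blast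
qed

text \<open>One elimination step: each row outside a row basis loses its expansion in that basis.
  \<open>L\<close> is 1 - N, where \<open>N\<close> writes only to rows in \<open>J\<close> and
  reads only rows outside \<open>J\<close>, so its kernel is trivial.\<close>

lemma left_null_rows:
  fixes M :: "complex^'c^'r"
  shows "\<exists>(L :: complex^'r^'r) J. invertible L \<and> card J = CARD('r) - rank M \<and> (\<forall>j\<in>J. (L ** M) $ j = 0)"
proof -
  obtain S where S: "S \<subseteq> rows M" "vec.independent S" "rows M \<subseteq> vec.span S" "card S = rank M"
    using vec.basis_exists[of "rows M"] by (metis row_rank_def_gen)
  have finS: "finite S" using S(2) by (rule vec.finiteI_independent)
  have "\<forall>b\<in>S. \<exists>i. row i M = b" using S(1) by (auto simp: rows_def)
  then obtain \<iota> where \<iota>: "\<And>b. b \<in> S \<Longrightarrow> row (\<iota> b) M = b" by metis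
  have inj: "inj_on \<iota> S" by (metis \<iota> inj_onI)
  define J where "J = - \<iota> ` S"
  have "\<exists>u. (\<Sum>b\<in>S. u b *s b) = row j M" for j
  proof -
    have "row j M \<in> vec.span S" using S(3) by (auto simp: rows_def)
    then obtain u where "row j M = (\<Sum>b\<in>S. u b *s b)"
      unfolding vec.span_finite[OF finS] by (rule imageE)
    then show ?thesis by (intro exI[of _ u]) simp
  qed
  then obtain u where u: "\<And>j. (\<Sum>b\<in>S. u j b *s b) = row j M" by metis
  define N where "N j i = (if j \<in> J \<and> i \<in> \<iota> ` S then u j (row i M) else 0)" for j i
  define L where "L = (\<chi> j i. (if j = i then 1 else 0) - N j i)"
  have L: "(L *v x) $ j = x $ j - (\<Sum>i\<in>UNIV. N j i * x $ i)" for x j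
    by (simp add: L_def matrix_vector_mult_def left_diff_distrib sum_subtractf if_distrib[of "\<lambda>x. x * _"] cong: if_cong)
  have "x = 0" if "L *v x = 0" for x
  proof -
    have *: "x $ j = (\<Sum>i\<in>UNIV. N j i * x $ i)" for j
      using L[of x j] that by simp
    have 0: "x $ j = 0" if "j \<notin> J" for j
      by (subst *) (simp add: N_def that)
    have z: "N j i * x $ i = 0" for i j
      using 0[of i] by (auto simp: N_def J_def)
    have "x $ j = 0" for j by (subst *) (simp only: z sum.neutral_const)
    then show ?thesis by (simp add: vec_eq_iff)
  qed
  then have "invertible L"
    using invertible_left_inverse matrix_left_invertible_ker by blast
  moreover have "card J = CARD('r) - rank M"
    using card_image[OF inj] S(4) finS by (simp add: J_def Compl_eq_Diff_UNIV card_Diff_subset)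
  moreover have "(L ** M) $ j = 0" if "j \<in> J" for j
  proof -
    have "(\<Sum>i\<in>UNIV. N j i * M $ i $ c) = M $ j $ c" for c
    proof -
      have "(\<Sum>i\<in>UNIV. N j i * M $ i $ c) = (\<Sum>i\<in>\<iota> ` S. u j (row i M) * M $ i $ c)"
        using that by (intro sum.mono_neutral_cong_right) (auto simp: N_def)
      also have "\<dots> = (\<Sum>b\<in>S. u j b * b $ c)"
        unfolding sum.reindex[OF inj]
      proof (intro sum.cong refl)
        fix b assume "b \<in> S"
        then have row: "row (\<iota> b) M = b" by (rule \<iota>)
        then have "M $ \<iota> b $ c = b $ c" by (auto simp: row_def vec_eq_iff)
        then show "((\<lambda>i. u j (row i M) * M $ i $ c) \<circ> \<iota>) b = u j b * b $ c"
          by (simp add: row)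
      qed
      also have "\<dots> = (\<Sum>b\<in>S. u j b *s b) $ c" by (simp add: sum_component)
      also have "\<dots> = M $ j $ c" by (simp add: u row_def)
      finally show ?thesis .
    qed
    then show ?thesis
      by (simp add: vec_eq_iff matrix_matrix_mult_def L_def left_diff_distrib sum_subtractf
          if_distrib[of "\<lambda>x. x * _"] cong: if_cong)
  qed
  ultimately show ?thesis by blast
qed

lemma polynomial_pencil_shift:
  fixes A :: "real^'n^'n" and B :: "real^'m^'n" and C :: "real^'n^'p" and D :: "real^'m^'p"
  shows "polynomial_pencil A B C D $ k $ c = [:pencil A B C D z $ k $ c:] -
     [:- z, 1:] * (case c of Inl i \<Rightarrow> if k = Inl i then 1 else 0 | Inr _ \<Rightarrow> 0)"
  by (cases k; cases c) (simp_all add: polynomial_pencil_def pencil_def system_matrix_def one_pCons)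

text \<open>Left multiplication by \<open>L\<close> pulls one factor s - z out of each row in
  \<open>J\<close>. The remaining matrix \<open>Q\<close> is at z a square selection of columns of
  the reduced pencil, hence singular when that pencil is not onto; this gives the extra factor.
  Since det L' is nonzero at z, all factors belong to the minor.\<close>

lemma order_minor_ge:
  fixes A :: "real^'n^'n" and B :: "real^'m^'n" and C :: "real^'n^'p" and D :: "real^'m^'p"
    and L :: "complex^('n + 'p)^('n + 'p)" and h :: "'n + 'p \<Rightarrow> 'n + 'm"
  assumes L: "invertible L" and J: "\<And>j. j \<in> J \<Longrightarrow> (L ** pencil A B C D z) $ j = 0"
    and ns: "\<not> surj ((*v) (reduced_pencil L J A B C D z z))"
  shows "[:- z, 1:] ^ Suc (card J) dvd det (\<chi> i j. polynomial_pencil A B C D $ i $ h j)" (is "_ dvd det ?M")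
proof -
  define L' :: "complex poly^('n + 'p)^('n + 'p)" where "L' = (\<chi> i j. [:L $ i $ j:])"
  define Q :: "complex poly^('n + 'p)^('n + 'p)" where
    "Q = (\<chi> j c. if j \<in> J then (case h c of Inl i \<Rightarrow> [:- L $ j $ Inl i:] | Inr _ \<Rightarrow> 0) else (L' ** ?M) $ j $ c)"
  define d where "d j = (if j \<in> J then [:- z, 1:] else 1)" for j :: "'n + 'p"
  have LM: "(L' ** ?M) $ j $ c = [:(L ** pencil A B C D z) $ j $ h c:] -
      [:- z, 1:] * (case h c of Inl i \<Rightarrow> [:L $ j $ Inl i:] | Inr _ \<Rightarrow> 0)" for j c
  proof -
    have sum_const: "(\<Sum>k\<in>UNIV. [:f k:]) = [:\<Sum>k\<in>UNIV. f k:]" for f :: "'n + 'p \<Rightarrow> complex"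
      by (rule poly_eqI) (simp add: coeff_sum coeff_pCons split: nat.split)
    have "(L' ** ?M) $ j $ c = (\<Sum>k\<in>UNIV. [:L $ j $ k:] * [:pencil A B C D z $ k $ h c:]
        - [:- z, 1:] * ([:L $ j $ k:] * (case h c of Inl i \<Rightarrow> if k = Inl i then 1 else 0 | Inr _ \<Rightarrow> 0)))"
      unfolding matrix_matrix_mult_def L'_def
      by (simp only: vec_lambda_beta polynomial_pencil_shift[of _ _ _ _ _ _ z] right_diff_distrib mult.left_commute[of "[:- z, 1:]"])
    also have "\<dots> = (\<Sum>k\<in>UNIV. [:L $ j $ k * pencil A B C D z $ k $ h c:]) - 
        [:- z, 1:] * (\<Sum>k\<in>UNIV. [:L $ j $ k:] * (case h c of Inl i \<Rightarrow> if k = Inl i then 1 else 0 | Inr _ \<Rightarrow> 0))"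
      unfolding sum_subtractf sum_distrib_left by (simp add: mult.commute)
    also have "(\<Sum>k\<in>UNIV. [:L $ j $ k:] * (case h c of Inl i \<Rightarrow> if k = Inl i then 1 else 0 | Inr _ \<Rightarrow> 0)) =
        (case h c of Inl i \<Rightarrow> [:L $ j $ Inl i:] | Inr _ \<Rightarrow> 0)"
      by (cases "h c") (simp_all add: if_distrib[of "\<lambda>x. _ * x"] cong: if_cong)
    finally show ?thesis
      by (simp add: sum_const matrix_matrix_mult_def)
  qed
  have "L' ** ?M = (\<chi> j. d j *s Q $ j)"
    unfolding vec_eq_iff
  proof (intro allI)
    fix j c
    show "(L' ** ?M) $ j $ c = (\<chi> j. d j *s Q $ j) $ j $ c"
    proof (cases "j \<in> J")
      case True
      then show ?thesis
        unfolding LM using J[OF True] by (simp add: d_def Q_def split: sum.split)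
    qed (simp add: d_def Q_def)
  qed
  then have "det L' * det ?M = prod d UNIV * det Q"
    using det_rows_mul[of d "\<lambda>j. Q $ j"] by (simp add: det_mul[symmetric])
  also have "prod d UNIV = [:- z, 1:] ^ card J"
    by (simp add: d_def prod.If_cases)
  finally have eq: "det L' * det ?M = [:- z, 1:] ^ card J * det Q" .
  let ?N = "\<chi> j c. reduced_pencil L J A B C D z z $ j $ h c"
  have "poly (Q $ j $ c) z = ?N $ j $ c" for j c
    by (simp add: Q_def LM reduced_pencil_def split: sum.split)
  then have "poly (det Q) z = det ?N"
    by (simp add: poly_det)
  also have "det ?N = 0"
  proof (rule ccontr)
    assume "det ?N \<noteq> 0"
    then obtain N' where N': "?N ** N' = mat 1"
      using invertible_det_nz invertible_def by blast
    \<comment> \<open>\<open>H\<close> selects the columns given by \<open>h\<close>, so a right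
      inverse of the selection yields one of the whole reduced pencil.\<close>
    define H :: "complex^('n + 'p)^('n + 'm)" where "H = (\<chi> k c. if h c = k then 1 else 0)"
    have "?N = reduced_pencil L J A B C D z z ** H"
      by (simp add: vec_eq_iff matrix_matrix_mult_def H_def if_distrib[of "\<lambda>x. _ * x"] cong: if_cong)
    then have "reduced_pencil L J A B C D z z *v (H *v (N' *v y)) = y" for y
      using N' by (simp add: matrix_vector_mul_assoc matrix_mul_assoc)
    then have "surj ((*v) (reduced_pencil L J A B C D z z))"
      by (rule surjI[where f = "\<lambda>y. H *v (N' *v y)"])
    with ns show False ..
  qed
  finally have "[:- z, 1:] dvd det Q" by (simp add: poly_eq_0_iff_dvd)
  then have dvd: "[:- z, 1:] ^ Suc (card J) dvd det L' * det ?M"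
    unfolding eq power_Suc2 by (intro mult_dvd_mono) auto
  have "poly (det L') z = det L"
    by (simp add: poly_det L'_def)
  then have L0: "poly (det L') z \<noteq> 0"
    using L invertible_det_nz by metis
  show ?thesis
  proof (cases "det ?M = 0")
    case False
    then have "Suc (card J) \<le> order z (det L' * det ?M)"
      using dvd L0 by (metis mult_eq_0_iff order_divides poly_0)
    also have "\<dots> = order z (det ?M)"
      using False L0 by (subst order_mult) (auto simp: order_0I)
    finally show ?thesis using order_divides by blast
  qed simp
qed

text \<open>Otherwise every full-order minor, and so their gcd, is divisible by (s - z)^(card J +
  1), although card J is the geometric multiplicity. The order of the gcd is meaningful because some
  minor is nonzero: the pencil is onto at any point that is not a zero.\<close>

lemma reduced_pencil_surj:
  fixes A :: "real^'n^'n" and B :: "real^'m^'n" and C :: "real^'n^'p" and D :: "real^'m^'p"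
  assumes ri: "right_invertible A B C D"
    and mult: "zero_algebraic_multiplicity A B C D z = zero_geometric_multiplicity A B C D z"
  obtains L :: "complex^('n + 'p)^('n + 'p)" and J where "invertible L"
    "\<And>j. j \<in> J \<Longrightarrow> (L ** pencil A B C D z) $ j = 0" "surj ((*v) (reduced_pencil L J A B C D z z))"
proof -
  obtain L :: "complex^('n + 'p)^('n + 'p)" and J where L: "invertible L"
    and cJ: "card J = CARD('n + 'p) - rank (pencil A B C D z)" and J: "\<And>j. j \<in> J \<Longrightarrow> (L ** pencil A B C D z) $ j = 0"
    using left_null_rows by blast
  have nr: "normal_rank A B C D = CARD('n + 'p)" using full_normal_rank[OF ri] by simp
  have "surj ((*v) (reduced_pencil L J A B C D z z))"
  proof (rule ccontr)
    assume ns: "\<not> ?thesis"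
    let ?Z = "zero_polynomial A B C D"
    have "[:- z, 1:] ^ Suc (card J) dvd ?Z"
      unfolding zero_polynomial_def nr
      using order_minor_ge[OF L J ns] by (intro Gcd_greatest) (auto simp: in_minors_iff_det simp del: card_sum)
    moreover have "?Z \<noteq> 0"
    proof -
      have "infinite (UNIV - invariant_zeros A B C D)"
        using finite_invariant_zeros[OF ri] infinite_UNIV_char_0[where 'a = complex] by simp
      then obtain \<mu> where "\<mu> \<notin> invariant_zeros A B C D" by (metis Diff_iff finite.emptyI ex_in_conv)
      then have "surj ((*v) (pencil A B C D \<mu>))"
        using pencil_surj[OF ri] by (metis surjI surj_def)
      then obtain h where h: "inj h" "det (\<chi> i j. pencil A B C D \<mu> $ i $ h j) \<noteq> 0"
        using nonzero_minor_exists by blast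
      let ?m = "det (\<chi> i j. polynomial_pencil A B C D $ i $ h j)"
      have "poly ?m \<mu> \<noteq> 0"
        using h(2) by (simp add: poly_det polynomial_pencil_shift[of _ _ _ _ _ _ \<mu>])
      then have "?m \<noteq> 0" by auto
      moreover have "?m \<in> minors CARD('n + 'p) (polynomial_pencil A B C D)"
        using h(1) by (auto simp: in_minors_iff_det simp del: card_sum)
      ultimately show ?thesis
        unfolding zero_polynomial_def nr by auto
    qed
    ultimately have "Suc (card J) \<le> order z ?Z" using order_divides by blast
    then show False
      using mult cJ nr by (simp add: zero_algebraic_multiplicity_def zero_geometric_multiplicity_def)
  qed
  then show ?thesis using that L J by blast
qed

context quadruple
begin

text \<open>A chain of length two modulo \<open>R\<close> is lifted to an exact chain of the pencil,
  to which \<open>reduced_kernel_in_R\<close> applies.\<close>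

lemma semisimple_at_zero:
  assumes "right_invertible A B C D"
    and "zero_algebraic_multiplicity A B C D z = zero_geometric_multiplicity A B C D z"
    and x: "x \<in> complexify V" and k: "shifted M0 z (shifted M0 z x) \<in> complexify R"
  shows "shifted M0 z x \<in> complexify R"
proof -
  let ?k = "shifted M0 z x"
  note subR = subspace_complexify[OF subspace_R]
  have kV: "?k \<in> complexify V"
    using x M0_V subspace_V by (intro shifted_closed)
  obtain \<rho> \<eta> where \<rho>: "\<rho> \<in> complexify R" "upper \<eta> = ?k - \<rho>" "pencil A B C D z *v \<eta> = 0"
    using kernel_from_R[OF kV k] by metis
  \<comment> \<open>Replacing the top of the chain by \<eta> changes it by \<rho>; the bottom
    \<open>x\<close> must absorb this, so \<rho>' is chosen to be sent to \<rho> by the shift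
    together with an input in the kernel of \<open>D\<close>.\<close>
  obtain \<rho>' u where u: "\<rho>' \<in> complexify R" "complex_matrix D *v u = 0" "shifted M0 z \<rho>' + complex_matrix B *v u = \<rho>"
    using pole_shift_R[OF \<rho>(1)] by blast
  let ?y = "x - \<rho>'"
  have V: "?y \<in> complexify V"
    using x u(1) complexify_mono[OF R_le_V] subspace_diff[OF subspace_complexify[OF subspace_V]] by blast
  have upper_part: "complex_matrix A *v y + complex_matrix B *v (complex_matrix F0 *v y - u) - z *s y =
      shifted M0 z y - complex_matrix B *v u" for y
    by (simp add: shifted_M0 vec.diff algebra_simps)
  have "complex_matrix D *v (complex_matrix F0 *v ?y - u) = complex_matrix D *v (complex_matrix F0 *v ?y)"
    by (simp only: vec.diff u(2) diff_zero)
  then have lower_part: "complex_matrix C *v ?y + complex_matrix D *v (complex_matrix F0 *v ?y - u) = 0"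
    by (simp only: output_F0_complex[OF V])
  have "shifted M0 z ?y - complex_matrix B *v u = upper \<eta>"
    by (simp only: \<rho>(2) shifted_linear(2) u(3)[symmetric]) simp
  then have "pencil A B C D z *v stack ?y (complex_matrix F0 *v ?y - u) = stack (upper \<eta>) 0"
    by (simp only: pencil_mult stack_simps upper_part lower_part)
  moreover obtain L :: "complex^('n + 'p)^('n + 'p)" and J where "invertible L"
    "\<And>j. j \<in> J \<Longrightarrow> (L ** pencil A B C D z) $ j = 0" "surj ((*v) (reduced_pencil L J A B C D z z))"
    using reduced_pencil_surj[OF assms(1,2)] by blast
  ultimately have "upper \<eta> \<in> complexify R"
    using reduced_kernel_in_R \<rho>(3) by blast
  then show ?thesis
    using \<rho>(1,2) subspace_add[OF subR] by fastforce
qed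

end

subsection \<open>The largest stabilizability output-nulling subspace\<close>

lemma linear_relation_exists:
  fixes v :: "nat \<Rightarrow> 'a::euclidean_space"
  shows "\<exists>c. (\<exists>i\<le>DIM('a). c i \<noteq> 0) \<and> (\<Sum>i\<le>DIM('a). c i *\<^sub>R v i) = 0"
proof (rule ccontr)
  assume "\<not> ?thesis"
  then have zero: "\<And>c. (\<Sum>i\<le>DIM('a). c i *\<^sub>R v i) = 0 \<Longrightarrow> \<forall>i\<le>DIM('a). c i = 0" by blast
  have inj: "inj_on v {..DIM('a)}"
  proof (rule inj_onI, rule ccontr)
    fix i j assume ij: "i \<in> {..DIM('a)}" "j \<in> {..DIM('a)}" "v i = v j" "i \<noteq> j"
    have "(\<Sum>l\<le>DIM('a). ((if l = i then 1 else 0) - (if l = j then 1 else 0)) *\<^sub>R v l) = 0"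
      using ij by (simp add: scaleR_left_diff_distrib sum_subtractf if_distrib[of "\<lambda>x. x *\<^sub>R _"] cong: if_cong)
    then show False using zero ij by fastforce
  qed
  have "independent (v ` {..DIM('a)})"
  proof (rule independent_if_scalars_zero)
    fix f x assume "(\<Sum>x\<in>v ` {..DIM('a)}. f x *\<^sub>R x) = 0" and x: "x \<in> v ` {..DIM('a)}"
    then have "(\<Sum>i\<le>DIM('a). f (v i) *\<^sub>R v i) = 0" by (simp add: sum.reindex[OF inj])
    then show "f x = 0" using zero[of "\<lambda>i. f (v i)"] x by auto
  qed simp
  then have "card (v ` {..DIM('a)}) \<le> DIM('a)" using independent_bound by blast
  then show False by (simp add: card_image[OF inj])
qed

lemma shifted_funpow:
  fixes M :: "real^'n^'n"
  defines "f \<equiv> (*v) (complex_matrix M)"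
  shows "(f ^^ i) (shifted M z x) = (f ^^ Suc i) x - z *s (f ^^ i) x"
proof -
  have "(f ^^ i) (v - z *s w) = (f ^^ i) v - z *s (f ^^ i) w" for v w
    by (induction i) (simp_all add: f_def vec.diff vec.scale)
  then show ?thesis by (simp add: funpow_swap1 f_def)
qed

text \<open>Roots of \<open>p\<close> are stripped one at a time: either the shifted
  \<open>x\<close> lies in \<open>N\<close> and \<open>x\<close> is the eigenvector, or it replaces
  \<open>x\<close> and the cofactor replaces \<open>p\<close>. The sum runs to a bound
  \<open>n\<close> rather than to the degree, so missing leading terms are harmless.\<close>

lemma quotient_eigenvector_of_poly:
  fixes M :: "real^'n^'n"
  defines "f \<equiv> (*v) (complex_matrix M)"
  assumes N: "subspace N" and V: "subspace V" "\<And>x. x \<in> V \<Longrightarrow> M *v x \<in> V"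
  assumes "p \<noteq> 0" "degree p \<le> n" "x \<in> complexify V" "x \<notin> complexify N"
    and "(\<Sum>i\<le>n. coeff p i *s (f ^^ i) x) \<in> complexify N"
  shows "\<exists>z y. y \<in> complexify V \<and> y \<notin> complexify N \<and> shifted M z y \<in> complexify N"
  using assms(5-)
proof (induction n arbitrary: p x)
  case (0 p x)
  then have "coeff p 0 \<noteq> 0" by (metis le_zero_eq leading_coeff_0_iff)
  then have "x = (1 / coeff p 0) *s (coeff p 0 *s x)"
    by (simp only: vec.scale_scale) simp
  moreover have "coeff p 0 *s x \<in> complexify N" using 0 by simp
  ultimately have "x \<in> complexify N" using complexify_smult[OF N] by metis
  then show ?case using 0 by blast
next
  case (Suc n p x)
  show ?case
  proof (cases "degree p \<le> n")
    case True
    then have "coeff p (Suc n) = 0" by (simp add: coeff_eq_0)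
    then show ?thesis using Suc.IH[OF Suc.prems(1) True Suc.prems(3,4)] Suc.prems(5) by simp
  next
    case False
    then have "degree p \<noteq> 0" by simp
    then obtain z where "poly p z = 0"
      using fundamental_theorem_of_algebra[of p] by (auto simp: constant_degree)
    then obtain q where q: "p = [:- z, 1:] * q" by (metis dvdE poly_eq_0_iff_dvd)
    have q0: "q \<noteq> 0" using q Suc.prems(1) by auto
    have dq: "degree q \<le> n"
      using degree_mult_eq[of "[:- z, 1:]" q] q q0 Suc.prems(2) by simp
    show ?thesis
    proof (cases "shifted M z x \<in> complexify N")
      case False
      have "(\<Sum>i\<le>Suc n. coeff p i *s (f ^^ i) x) =
          (\<Sum>i\<le>Suc n. coeff (pCons 0 q) i *s (f ^^ i) x) - (\<Sum>i\<le>Suc n. coeff q i *s (z *s (f ^^ i) x))"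
        unfolding sum_subtractf[symmetric]
        by (intro sum.cong refl) (simp only: vec.scale_scale vec.scale_left_diff_distrib[symmetric], simp add: q algebra_simps)
      also have "(\<Sum>i\<le>Suc n. coeff (pCons 0 q) i *s (f ^^ i) x) = (\<Sum>i\<le>n. coeff q i *s (f ^^ Suc i) x)"
        by (subst sum.atMost_Suc_shift) simp
      also have "(\<Sum>i\<le>Suc n. coeff q i *s (z *s (f ^^ i) x)) = (\<Sum>i\<le>n. coeff q i *s (z *s (f ^^ i) x))"
        using dq by (simp add: coeff_eq_0)
      also have "(\<Sum>i\<le>n. coeff q i *s (f ^^ Suc i) x) - (\<Sum>i\<le>n. coeff q i *s (z *s (f ^^ i) x)) =
          (\<Sum>i\<le>n. coeff q i *s (f ^^ i) (shifted M z x))"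
        unfolding sum_subtractf[symmetric] f_def shifted_funpow by (simp only: vec.scale_right_diff_distrib)
      finally have "(\<Sum>i\<le>n. coeff q i *s (f ^^ i) (shifted M z x)) \<in> complexify N"
        using Suc.prems(5) by simp
      then show ?thesis
        using Suc.IH[OF q0 dq _ False] shifted_closed[OF V Suc.prems(3)] by blast
    qed (use Suc.prems in blast)
  qed
qed

lemma quotient_eigenvector:
  fixes M :: "real^'n^'n"
  assumes N: "subspace N" "\<And>x. x \<in> N \<Longrightarrow> M *v x \<in> N" and V: "subspace V" "\<And>x. x \<in> V \<Longrightarrow> M *v x \<in> V"
    and NV: "N \<subseteq> V" "N \<noteq> V"
  obtains z x where "z \<in> spectrum_on M V" "x \<in> complexify V" "x \<notin> complexify N" "shifted M z x \<in> complexify N"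
proof -
  let ?f = "(*v) (complex_matrix M)"
  obtain v where v: "v \<in> V" "v \<notin> N" using NV by blast
  let ?x = "of_real_vec v"
  obtain c where c: "\<exists>i\<le>DIM(complex^'n). c i \<noteq> 0" "(\<Sum>i\<le>DIM(complex^'n). c i *\<^sub>R (?f ^^ i) ?x) = 0"
    using linear_relation_exists[of "\<lambda>i. (?f ^^ i) ?x"] by blast
  define p where "p = (\<Sum>i\<le>DIM(complex^'n). monom (complex_of_real (c i)) i)"
  have p: "coeff p i = (if i \<le> DIM(complex^'n) then of_real (c i) else 0)" for i
    by (simp add: p_def coeff_sum)
  have "p \<noteq> 0" using c(1) p by (metis coeff_0 of_real_eq_0_iff)
  moreover have "degree p \<le> DIM(complex^'n)" by (rule degree_le) (simp add: p)
  moreover have "(\<Sum>i\<le>DIM(complex^'n). coeff p i *s (?f ^^ i) ?x) = 0"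
    using c(2) by (simp add: p scaleR_eq_smult)
  ultimately obtain z x where x: "x \<in> complexify V" "x \<notin> complexify N" "shifted M z x \<in> complexify N"
    using quotient_eigenvector_of_poly[OF N(1) V, of p "DIM(complex^'n)" ?x] v N(1) V(1)
      subspace_0[OF subspace_complexify[OF N(1)]] by auto
  \<comment> \<open>If z were not in the spectrum on \<open>V\<close>, the shift would be injective
    there and map \<open>N\<close> onto itself, forcing \<open>x\<close> into
    \<open>N\<close>.\<close>
  moreover have "z \<in> spectrum_on M V"
  proof (rule ccontr)
    assume z: "z \<notin> spectrum_on M V"
    have inj: "y = 0" if "y \<in> complexify V" "shifted M z y = 0" for y
      using z that by (auto simp: spectrum_on_alt)
    have "shifted M z ` complexify N = complexify N"
      using N inj complexify_mono[OF NV(1)]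
      by (intro linear_image_eq_of_injective linear_shifted subspace_complexify shifted_closed) auto
    then have "shifted M z x \<in> shifted M z ` complexify N" using x(3) by simp
    then obtain y where y: "y \<in> complexify N" "shifted M z x = shifted M z y" by (rule imageE)
    then have "shifted M z (x - y) = 0" by (simp only: shifted_linear(2)) simp
    moreover have "x - y \<in> complexify V"
      using x(1) y(1) complexify_mono[OF NV(1)] subspace_diff[OF subspace_complexify[OF V(1)]] by blast
    ultimately show False using inj y(1) x(2) by fastforce
  qed
  ultimately show ?thesis using that by blast
qed

definition stable_reals :: "time_domain \<Rightarrow> real set" where
  "stable_reals T = {l. complex_of_real l \<in> stability_region T}"

lemma infinite_stable_reals: "infinite (stable_reals T)"
proof (cases T)
  case Continuous
  then show ?thesis by (simp add: stable_reals_def infinite_Iio flip: lessThan_def)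
next
  case Discrete
  then have "{-1<..<1} \<subseteq> stable_reals T" by (auto simp: stable_reals_def)
  moreover have "infinite {-1<..<1::real}" by (simp add: infinite_Ioo)
  ultimately show ?thesis using finite_subset by blast
qed

section \<open>The stable modes span the largest stabilizability subspace\<close>

context quadruple
begin

lemma span_modes_stabilizability:
  assumes "\<Lambda> \<subseteq> stable_reals T"
  shows "stabilizability_output_nulling T A B C D (span (modes \<Lambda>))"
proof -
  obtain S where S: "S \<subseteq> modes \<Lambda>" "independent S" "span S = span (modes \<Lambda>)"
  proof -
    obtain S where "S \<subseteq> modes \<Lambda>" "independent S" "modes \<Lambda> \<subseteq> span S"
      using maximal_independent_subset by blast
    then show ?thesis
      using that[of S] by (simp add: span_minimal span_mono subset_antisym)
  qed
  have "\<forall>v\<in>S. \<exists>l w. l \<in> \<Lambda> \<and> A *v v + B *v w = l *\<^sub>R v \<and> C *v v + D *v w = 0"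
    using S(1) by (auto simp: modes_def)
  then obtain l w where lw: "\<And>v. v \<in> S \<Longrightarrow> l v \<in> \<Lambda> \<and> A *v v + B *v w v = l v *\<^sub>R v \<and> C *v v + D *v w v = 0"
    by metis
  obtain F :: "real^'n^'m" where F: "\<And>b. b \<in> S \<Longrightarrow> F *v b = w b"
    using feedback_exists[OF S(2)] by blast
  have fr: "friend A B C D (span S) F"
    using lw F by (intro friend_span) (auto simp: closed_loop_mult span_base span_scale)
  moreover have "spectrum_on (A + B ** F) (span S) \<subseteq> stability_region T"
    using lw F assms
    by (intro spectrum_on_eigenvectors) (fastforce simp: closed_loop_mult stable_reals_def subset_eq)
  ultimately show ?thesis
    unfolding stabilizability_output_nulling_def S(3) by auto
qed

lemma mode_mod_R:
  assumes "v \<in> modes \<Lambda>"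
  shows "\<exists>l\<in>\<Lambda>. M0 *v v - l *\<^sub>R v \<in> R"
proof -
  obtain l w where lw: "l \<in> \<Lambda>" "A *v v + B *v w = l *\<^sub>R v" "C *v v + D *v w = 0"
    using assms by (auto simp: modes_def)
  have v: "v \<in> V" using assms modes_le_V by blast
  then have "A *v v + B *v w \<in> V" using lw subspace_V by (simp add: subspace_scale)
  from equal_mod_R[OF v this lw(3)] have "M0 *v v - l *\<^sub>R v = - (B *v (w - F0 *v v))" "B *v (w - F0 *v v) \<in> R"
    using lw(2) by simp_all
  then show ?thesis using lw(1) subspace_neg[OF subspace_R] by metis
qed

text \<open>Otherwise the action on \<open>V1\<close> modulo the span W of the modes has an
  eigenvector x at a stable z. On \<open>V1\<close> the two feedbacks agree modulo \<open>R\<close>,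
  so (M0 - z) x is in W. Subtracting from x a suitable element of W gives x' with (M0 - z)^2 x' in
  \<open>R\<close>. Off the zeros this puts x' into \<open>R\<close>. At a zero semisimplicity makes
  x' an eigenvector modulo \<open>R\<close>, hence a sum of modes modulo \<open>R\<close>. Either
  way x' lies in W, and so does x.\<close>

lemma stabilizability_le_span_modes:
  assumes ri: "right_invertible A B C D"
    and mult: "\<And>z. z \<in> minimum_phase_zeros T A B C D \<Longrightarrow>
           zero_algebraic_multiplicity A B C D z = zero_geometric_multiplicity A B C D z"
    and real: "minimum_phase_zeros T A B C D \<subseteq> \<real>"
    and V1: "stabilizability_output_nulling T A B C D V1"
  shows "V1 \<subseteq> span (modes (stable_reals T))" (is "_ \<subseteq> ?W")
proof (rule ccontr)
  assume nle: "\<not> V1 \<subseteq> ?W"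
  obtain F1 where sub1: "subspace V1" and F1: "friend A B C D V1 F1" "spectrum_on (A + B ** F1) V1 \<subseteq> stability_region T"
    using V1 by (auto simp: stabilizability_output_nulling_def)
  define M1 where "M1 = A + B ** F1"
  have M1_V1: "M1 *v v \<in> V1" and C1: "C *v v + D *v (F1 *v v) = 0" if "v \<in> V1" for v
    using F1(1) that by (auto simp: friend_def M1_def closed_loop_mult)
  have V1V: "V1 \<subseteq> V"
    using sub1 F1(1) by (intro V_star_greatest(2)) (auto simp: output_nulling_def)
  have RW: "R \<subseteq> ?W" by (intro R_le_span_modes infinite_stable_reals)
  have WV: "?W \<subseteq> V" using modes_le_V subspace_V by (simp add: span_minimal)
  have M0W: "M0 *v v \<in> ?W" if "v \<in> ?W" for v
    using that
  proof (induction rule: span_induct_alt)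
    case (step c x y)
    obtain l where "M0 *v x - l *\<^sub>R x \<in> R" using mode_mod_R[OF step(1)] by blast
    then have "(M0 *v x - l *\<^sub>R x) + l *\<^sub>R x \<in> ?W"
      using RW span_base[OF step(1)] by (intro span_add span_scale) auto
    then show ?case
      using step by (simp add: matrix_vector_right_distrib matrix_vector_mult_scaleR span_add span_scale)
  qed (simp add: span_zero)
  have M10: "M1 *v v - M0 *v v \<in> R" if v: "v \<in> V1" for v
  proof -
    have "A *v v + B *v (F1 *v v) \<in> V" using M1_V1[OF v] V1V by (auto simp: M1_def closed_loop_mult)
    from equal_mod_R[OF _ this C1[OF v]] show ?thesis
      using v V1V by (auto simp: M1_def closed_loop_mult)
  qed
  have sub_N: "subspace (V1 \<inter> ?W)" using sub1 by (simp add: subspace_inter)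
  have M1_N: "M1 *v x \<in> V1 \<inter> ?W" if "x \<in> V1 \<inter> ?W" for x
  proof -
    have "(M1 *v x - M0 *v x) + M0 *v x \<in> ?W"
      using that M10 RW M0W by (intro span_add) auto
    then show ?thesis using that M1_V1 by simp
  qed
  obtain z x where z: "z \<in> spectrum_on M1 V1" and x: "x \<in> complexify V1" "x \<notin> complexify (V1 \<inter> ?W)"
      "shifted M1 z x \<in> complexify (V1 \<inter> ?W)"
    using quotient_eigenvector[OF sub_N M1_N sub1 M1_V1] nle by blast
  have z_stable: "z \<in> stability_region T" using z F1(2) by (auto simp: M1_def)
  note sR = subspace_complexify[OF subspace_R] and sV = subspace_complexify[OF subspace_V]
    and sW = subspace_complexify[OF subspace_span[of "modes (stable_reals T)"]]
  have xV: "x \<in> complexify V" using x(1) complexify_mono[OF V1V] by blast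
  have xW: "x \<notin> complexify ?W" using x(1,2) by (auto simp: complexify_def)
  have y: "shifted M0 z x \<in> complexify ?W"
  proof -
    have "complex_matrix M1 *v x - complex_matrix M0 *v x \<in> complexify ?W"
      using x(1) M10 RW by (auto simp: complexify_def)
    moreover have "shifted M1 z x \<in> complexify ?W" using x(3) by (auto simp: complexify_def)
    ultimately have "shifted M1 z x - (complex_matrix M1 *v x - complex_matrix M0 *v x) \<in> complexify ?W"
      using subspace_diff[OF sW] by blast
    then show ?thesis by (simp add: algebra_simps)
  qed
  \<comment> \<open>Modulo \<open>R\<close> the generators of W are eigenvectors of
    \<open>M0\<close>: those with eigenvalue other than z lie in the range of M0 - z up to
    \<open>R\<close>, and those at z are killed modulo \<open>R\<close> and go into
    \<open>k\<close>.\<close>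
  have split: "\<exists>\<omega> k. \<omega> \<in> complexify ?W \<and> k \<in> complexify V \<and> shifted M0 z k \<in> complexify R \<and> y = shifted M0 z \<omega> + k"
    if "y \<in> complexify ?W" for y
    using that
  proof (induction rule: complexify_span_induct)
    case (base v)
    obtain l where l: "M0 *v v - l *\<^sub>R v \<in> R" using mode_mod_R[OF base] by blast
    define r where "r = of_real_vec (M0 *v v - l *\<^sub>R v)"
    have r: "r \<in> complexify R" using l by (simp add: r_def subspace_R)
    have vV: "of_real_vec v \<in> complexify V" using base modes_le_V by (auto simp: subspace_V)
    have vW: "of_real_vec v \<in> complexify ?W" using base by (simp add: span_base)
    have sv: "shifted M0 z (of_real_vec v) = (of_real l - z) *s of_real_vec v + r"
      by (simp add: r_def of_real_vec_simps vec.scale_left_diff_distrib)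
    show ?case
    proof (cases "of_real l = z")
      case True
      then have "shifted M0 z (of_real_vec v) = r" using sv by simp
      then show ?thesis
        using vV r subspace_0[OF sW]
        by (intro exI[of _ 0] exI[of _ "of_real_vec v"]) (simp only: shifted_linear(5), simp)
    next
      case False
      define c where "c = 1 / (of_real l - z)"
      have c: "c * (of_real l - z) = 1" using False by (simp add: c_def)
      have "shifted M0 z (c *s of_real_vec v) = c *s ((of_real l - z) *s of_real_vec v + r)"
        by (simp only: shifted_linear(3) sv)
      also have "\<dots> = of_real_vec v + c *s r"
        by (simp only: vec.scale_right_distrib vec.scale_scale c vec.scale_one)
      finally have eq: "of_real_vec v = shifted M0 z (c *s of_real_vec v) + (- c) *s r" by simp
      have "(- c) *s r \<in> complexify R" using r complexify_smult[OF subspace_R] by blast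
      moreover from this have "shifted M0 z ((- c) *s r) \<in> complexify R"
        using M0_R subspace_R by (intro shifted_closed)
      ultimately show ?thesis
        using eq complexify_smult[OF subspace_span vW] complexify_mono[OF R_le_V]
        by (intro exI[of _ "c *s of_real_vec v"] exI[of _ "(- c) *s r"]) auto
    qed
  next
    case (add v w)
    then obtain \<omega> k \<omega>' k' where "\<omega> \<in> complexify ?W" "k \<in> complexify V" "shifted M0 z k \<in> complexify R" "v = shifted M0 z \<omega> + k"
      "\<omega>' \<in> complexify ?W" "k' \<in> complexify V" "shifted M0 z k' \<in> complexify R" "w = shifted M0 z \<omega>' + k'" by blast
    then show ?case
      by (intro exI[of _ "\<omega> + \<omega>'"] exI[of _ "k + k'"] conjI)
        (simp_all only: shifted_linear(1) subspace_add[OF sW] subspace_add[OF sV] subspace_add[OF sR], simp)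
  next
    case (smult c v)
    then obtain \<omega> k where "\<omega> \<in> complexify ?W" "k \<in> complexify V" "shifted M0 z k \<in> complexify R" "v = shifted M0 z \<omega> + k"
      by blast
    then show ?case
      by (intro exI[of _ "c *s \<omega>"] exI[of _ "c *s k"] conjI)
        (simp_all only: shifted_linear(3) complexify_smult subspace_V subspace_R subspace_span vec.scale_right_distrib)
  next
    case zero
    show ?case
      using subspace_0[OF sW] subspace_0[OF sV] subspace_0[OF sR]
      by (intro exI[of _ 0] conjI) (simp_all only: shifted_linear(5), simp)
  qed
  obtain \<omega> k where \<omega>: "\<omega> \<in> complexify ?W" "k \<in> complexify V" "shifted M0 z k \<in> complexify R" "shifted M0 z x = shifted M0 z \<omega> + k"
    using split[OF y] by blast
  define x' where "x' = x - \<omega>"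
  have x'k: "shifted M0 z x' = k" unfolding x'_def shifted_linear(2) \<omega>(4) by simp
  have x'V: "x' \<in> complexify V"
    unfolding x'_def using xV \<omega>(1) complexify_mono[OF WV] subspace_diff[OF sV] by blast
  have x'W: "x' \<notin> complexify ?W"
    using xW \<omega>(1) subspace_add[OF sW, of x' \<omega>] by (auto simp: x'_def)
  show False
  proof (cases "z \<in> invariant_zeros A B C D")
    case False
    have surj: "\<exists>\<xi>. pencil A B C D z *v \<xi> = stack x 0" for x
      using pencil_surj[OF ri False] by blast
    have "k \<in> complexify R" by (rule no_mode_at_nonzero[OF surj \<omega>(2,3)])
    then have "x' \<in> complexify R" using x'k by (intro no_mode_at_nonzero[OF surj x'V]) simp
    then show False using x'W complexify_mono[OF RW] by blast
  next
    case True
    then have mp: "z \<in> minimum_phase_zeros T A B C D" using z_stable by (simp add: minimum_phase_zeros_def)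
    then obtain l where l: "z = of_real l" using real by (auto elim!: Reals_cases)
    have "shifted M0 z x' \<in> complexify R"
      using semisimple_at_zero[OF ri mult[OF mp] x'V] \<omega>(3) x'k by simp
    then obtain \<rho> \<xi> where \<rho>: "\<rho> \<in> complexify R" "upper \<xi> = x' - \<rho>" "pencil A B C D z *v \<xi> = 0"
      using kernel_from_R[OF x'V] by metis
    \<comment> \<open>Because z is real, the real and imaginary parts of a kernel vector are modes
      separately.\<close>
    have "re_vec (upper \<xi>) \<in> modes (stable_reals T)" "im_vec (upper \<xi>) \<in> modes (stable_reals T)"
      using \<rho>(3)[unfolded pencil_mult_eq_0_iff, unfolded complex_vec_eq_iff] z_stable
      by (auto simp: modes_def stable_reals_def l)
    then have "upper \<xi> \<in> complexify ?W" by (simp add: complexify_def span_base)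
    then have "upper \<xi> + \<rho> \<in> complexify ?W"
      using \<rho>(1) complexify_mono[OF RW] by (intro subspace_add[OF sW]) auto
    then show False using \<rho>(2) x'W by simp
  qed
qed

theorem V_star_g_eq_span_modes:
  assumes "right_invertible A B C D"
    and "\<And>z. z \<in> minimum_phase_zeros T A B C D \<Longrightarrow>
           zero_algebraic_multiplicity A B C D z = zero_geometric_multiplicity A B C D z"
    and "minimum_phase_zeros T A B C D \<subseteq> \<real>"
  shows "V_star_g T A B C D = span (modes (stable_reals T))"
  unfolding V_star_g_def
  using span_modes_stabilizability[OF order.refl] stabilizability_le_span_modes[OF assms]
  by (intro Greatest_equality)

end

subsection \<open>Tracking\<close>

definition steady_frequency :: "time_domain \<Rightarrow> real" where
  "steady_frequency T = (case T of Continuous \<Rightarrow> 0 | Discrete \<Rightarrow> 1)"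

lemma steady_state_frequency_alt: "steady_state_frequency T = of_real (steady_frequency T)"
  by (cases T) (simp_all add: steady_frequency_def)

lemma steady_frequency_unstable: "complex_of_real (steady_frequency T) \<notin> stability_region T"
  by (cases T) (simp_all add: steady_frequency_def)

lemma static_gain_alt:
  "static_gain T A B C D F = D + (C + D ** F) ** matrix_inv (mat (steady_frequency T) - (A + B ** F)) ** B"
  by (cases T) (simp_all add: steady_frequency_def)

lemma mat_mult: "mat s *v x = s *\<^sub>R x" for x :: "real^'n"
  by (simp add: vec_eq_iff matrix_vector_mult_def mat_def if_distrib[of "\<lambda>x. x * _"] cong: if_cong)

lemma steady_state_inverse:
  assumes "spectrum M \<subseteq> stability_region T"
  defines "E \<equiv> mat (steady_frequency T) - M"
  shows "E *v (matrix_inv E *v x) = x" "matrix_inv E *v (E *v x) = x"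
proof -
  have "y = 0" if "E *v y = 0" for y
  proof (rule ccontr)
    assume "y \<noteq> 0"
    moreover have "M *v y = steady_frequency T *\<^sub>R y"
      using that by (simp add: E_def matrix_vector_mult_diff_rdistrib mat_mult)
    ultimately show False
      using real_eigenvalue_in_spectrum assms(1) steady_frequency_unstable by blast
  qed
  then have "invertible E" by (simp add: invertible_left_inverse matrix_left_invertible_ker)
  then show "E *v (matrix_inv E *v x) = x" "matrix_inv E *v (E *v x) = x"
    using someI_ex[of "\<lambda>E'. E ** E' = mat 1 \<and> E' ** E = mat 1"]
    by (auto simp: matrix_vector_mul_assoc matrix_inv_def invertible_def)
qed

lemma pencil_real_surj:
  assumes "right_invertible A B C D" "complex_of_real s \<notin> invariant_zeros A B C D"
  shows "\<exists>v w. A *v v + B *v w = s *\<^sub>R v + x \<and> C *v v + D *v w = y"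
proof -
  obtain \<xi> where "pencil A B C D (of_real s) *v \<xi> = stack (of_real_vec x) (of_real_vec y)"
    using pencil_surj[OF assms] by blast
  then have eq: "complex_matrix A *v upper \<xi> + complex_matrix B *v lower \<xi> - of_real s *s upper \<xi> = of_real_vec x"
      "complex_matrix C *v upper \<xi> + complex_matrix D *v lower \<xi> = of_real_vec y"
    unfolding pencil_mult by (metis stack_simps(1), metis stack_simps(2))
  from arg_cong[OF eq(1), of re_vec] arg_cong[OF eq(2), of re_vec]
  show ?thesis
    by (intro exI[of _ "re_vec (upper \<xi>)"] exI[of _ "re_vec (lower \<xi>)"]) (simp add: algebra_simps)
qed

text \<open>The steady-state frequency is not a zero, so some equilibrium x with input u has output
  r. Under the feedback it is sustained by the constant input u - F x, which the static gain
  therefore maps to r.\<close>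

lemma static_gain_right_inverse:
  fixes F :: "real^'n^'m" and C :: "real^'n^'p"
  assumes ri: "right_invertible A B C D" and nz: "steady_state_frequency T \<notin> invariant_zeros A B C D"
    and spec: "spectrum (A + B ** F) \<subseteq> stability_region T"
  shows "\<exists>G :: real^'p^'m. static_gain T A B C D F ** G = mat 1"
proof -
  let ?E = "mat (steady_frequency T) - (A + B ** F)"
  have "\<exists>g. static_gain T A B C D F *v g = r" for r
  proof -
    obtain x u where xu: "A *v x + B *v u = steady_frequency T *\<^sub>R x" "C *v x + D *v u = r"
      using pencil_real_surj[OF ri, of "steady_frequency T" 0 r] nz by (auto simp: steady_state_frequency_alt)
    define g where "g = u - F *v x"
    have "?E *v x = B *v g"
      by (simp add: matrix_vector_mult_diff_rdistrib mat_mult closed_loop_mult g_def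
          matrix_vector_mult_diff_distrib flip: xu(1))
    then have "matrix_inv ?E *v (B *v g) = x"
      using steady_state_inverse(2)[OF spec] by metis
    then have "static_gain T A B C D F *v g = D *v g + (C + D ** F) *v x"
      by (simp add: static_gain_alt matrix_vector_mult_add_rdistrib flip: matrix_vector_mul_assoc)
    also have "\<dots> = r"
      by (simp add: closed_loop_mult g_def matrix_vector_mult_diff_distrib flip: xu(2))
    finally show ?thesis by blast
  qed
  then have "surj ((*v) (static_gain T A B C D F))" by (metis surjI surj_def)
  then show ?thesis by (simp add: matrix_right_invertible_surjective)
qed

section \<open>Convergence to the steady state\<close>

lemma scalar_exponential_decay:
  fixes c :: "real \<Rightarrow> real"
  assumes "\<And>t. t \<ge> 0 \<Longrightarrow> (c has_vector_derivative l * c t) (at t within {0..})" and l: "l < 0"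
  shows "(c \<longlongrightarrow> 0) at_top"
proof -
  have "((\<lambda>t. c t * exp (- l * t)) has_derivative (\<lambda>h. 0)) (at t within {0..})" if "t \<in> {0..}" for t
  proof -
    have "((\<lambda>t. c t * exp (- l * t)) has_real_derivative 0) (at t within {0..})"
      using assms(1)[of t] that unfolding has_real_derivative_iff_has_vector_derivative[symmetric]
      by (auto intro!: derivative_eq_intros simp: algebra_simps)
    then show ?thesis by (simp add: has_field_derivative_def lambda_zero)
  qed
  then obtain k where k: "\<And>t. t \<in> {0..} \<Longrightarrow> c t * exp (- l * t) = k"
    using has_derivative_zero_constant[of "{0..}" "\<lambda>t. c t * exp (- l * t)"] by (auto simp: convex_real_interval)
  have "c t = k * exp (l * t)" if "t \<ge> 0" for t
    using k[of t] that by (simp add: exp_minus field_simps)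
  then have "\<forall>\<^sub>F t in at_top. k * exp (l * t) = c t"
    by (intro eventually_mono[OF eventually_ge_at_top[of 0]]) simp
  moreover have "((\<lambda>t. k * exp (l * t)) \<longlongrightarrow> 0) at_top"
    using l by real_asymp
  ultimately show ?thesis by (rule Lim_transform_eventually[rotated])
qed

text \<open>The coordinate functionals of an eigenbasis are left eigenvectors, so they split the
  closed loop into scalar equations.\<close>

lemma eigenbasis_coordinates:
  fixes M :: "real^'n^'n"
  assumes S: "independent S" "span S = UNIV" and eig: "\<And>b. b \<in> S \<Longrightarrow> M *v b = l b *\<^sub>R b"
  obtains \<phi> :: "real^'n \<Rightarrow> real^'n \<Rightarrow> real" where "\<And>b. bounded_linear (\<phi> b)"
    "\<And>y. (\<Sum>b\<in>S. \<phi> b y *\<^sub>R b) = y" "\<And>b y. b \<in> S \<Longrightarrow> \<phi> b (M *v y) = l b * \<phi> b y"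
proof -
  have fin: "finite S" using S(1) by (rule finiteI_independent)
  have "\<exists>f :: real^'n \<Rightarrow> real. linear f \<and> (\<forall>a\<in>S. f a = (if a = b then 1 else 0))" for b
    using linear_independent_extend[OF S(1), of "\<lambda>a. if a = b then 1 else 0 :: real"] by simp
  then obtain \<phi> :: "real^'n \<Rightarrow> real^'n \<Rightarrow> real" where \<phi>: "\<And>b. linear (\<phi> b)"
    "\<And>a b. a \<in> S \<Longrightarrow> \<phi> b a = (if a = b then 1 else 0)" by metis
  show ?thesis
  proof (rule that[of \<phi>])
    show "bounded_linear (\<phi> b)" for b using \<phi>(1) by (simp add: linear_conv_bounded_linear)
    have "linear (\<lambda>y. \<Sum>b\<in>S. \<phi> b y *\<^sub>R b)"
      by (intro linearI) (simp_all add: linear_add[OF \<phi>(1)] linear_scale[OF \<phi>(1)] scaleR_left_distrib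
          sum.distrib scaleR_sum_right)
    then show "(\<Sum>b\<in>S. \<phi> b y *\<^sub>R b) = y" for y
      by (rule linear_eq_on_span[OF _ linear_ident, of _ S])
        (auto simp: S(2) \<phi>(2) fin if_distrib[of "\<lambda>x. x *\<^sub>R _"] cong: if_cong)
    fix b y assume b: "b \<in> S"
    have "linear (\<lambda>y. \<phi> b (M *v y))"
      using linear_compose[OF matrix_vector_mul_linear \<phi>(1)] by (simp add: o_def)
    moreover have "linear (\<lambda>y. l b * \<phi> b y)"
      by (intro linearI) (simp_all add: linear_add[OF \<phi>(1)] linear_scale[OF \<phi>(1)] algebra_simps)
    ultimately show "\<phi> b (M *v y) = l b * \<phi> b y"
      by (rule linear_eq_on_span[where B = S]) (auto simp: S(2) \<phi>(2) eig linear_scale[OF \<phi>(1)])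
  qed
qed

lemma tracks_constant_references_if_eigenbasis:
  fixes F :: "real^'n^'m"
  assumes S: "independent S" "span S = UNIV"
    and eig: "\<And>b. b \<in> S \<Longrightarrow> (A + B ** F) *v b = l b *\<^sub>R b" "\<And>b. b \<in> S \<Longrightarrow> l b \<in> stable_reals T"
    and gain: "static_gain T A B C D F ** G = mat 1"
  shows "tracks_constant_references T A B C D F G"
proof -
  let ?M = "A + B ** F"
  have "spectrum_on ?M (span S) \<subseteq> stability_region T"
    using eig by (intro spectrum_on_eigenvectors) (fastforce simp: stable_reals_def)
  then have spec: "spectrum ?M \<subseteq> stability_region T" by (simp add: S(2))
  obtain \<phi> :: "real^'n \<Rightarrow> real^'n \<Rightarrow> real" where \<phi>: "\<And>b. bounded_linear (\<phi> b)"
    "\<And>y. (\<Sum>b\<in>S. \<phi> b y *\<^sub>R b) = y" "\<And>b y. b \<in> S \<Longrightarrow> \<phi> b (?M *v y) = l b * \<phi> b y"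
    using eigenbasis_coordinates[OF S eig(1)] by blast
  \<comment> \<open>The equilibrium under the constant input \<open>G *v r\<close>; deviations from
    it obey the closed loop without input.\<close>
  define xs where "xs r = matrix_inv (mat (steady_frequency T) - ?M) *v (B *v (G *v r))" for r
  have "(mat (steady_frequency T) - ?M) *v xs r = B *v (G *v r)" for r
    unfolding xs_def using steady_state_inverse(1)[OF spec] by blast
  then have xs: "?M *v xs r + B *v (G *v r) = steady_frequency T *\<^sub>R xs r" for r
    by (metis (no_types) diff_add_cancel add.commute mat_mult matrix_vector_mult_diff_rdistrib)
  have "static_gain T A B C D F *v (G *v r) = D *v (G *v r) + (C + D ** F) *v xs r" for r
    by (simp add: static_gain_alt matrix_vector_mult_add_rdistrib xs_def flip: matrix_vector_mul_assoc)
  moreover have "static_gain T A B C D F *v (G *v r) = r" for r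
    using gain by (simp add: matrix_vector_mul_assoc)
  ultimately have out: "D *v (G *v r) + (C + D ** F) *v xs r = r" for r by metis
  have out_eq: "C *v x + D *v (F *v x + G *v r) = (C + D ** F) *v (x - xs r) + r" for x r
    by (subst (2) out[of r, symmetric])
      (simp add: closed_loop_mult matrix_vector_mult_diff_distrib matrix_vector_right_distrib)
  \<comment> \<open>The arbitrary filter serves both time domains. The input law is required only
    eventually, since in continuous time it is known for t \<ge> 0 alone.\<close>
  have limit: "((\<lambda>t. C *v x t + D *v u t) \<longlongrightarrow> r) \<F>"
    if "\<forall>\<^sub>F t in \<F>. u t = F *v x t + G *v r" "\<And>b. b \<in> S \<Longrightarrow> ((\<lambda>t. \<phi> b (x t - xs r)) \<longlongrightarrow> 0) \<F>" for x u r \<F>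
  proof -
    have "((\<lambda>t. \<Sum>b\<in>S. \<phi> b (x t - xs r) *\<^sub>R b) \<longlongrightarrow> (\<Sum>b\<in>S. 0 *\<^sub>R b)) \<F>"
      using that(2) by (intro tendsto_sum tendsto_scaleR tendsto_const)
    then have "((\<lambda>t. x t - xs r) \<longlongrightarrow> 0) \<F>" by (simp add: \<phi>(2))
    then have "((\<lambda>t. (C + D ** F) *v (x t - xs r) + r) \<longlongrightarrow> (C + D ** F) *v 0 + r) \<F>"
      by (intro tendsto_add tendsto_const bounded_linear.tendsto[OF matrix_vector_mul_bounded_linear])
    then have lim: "((\<lambda>t. (C + D ** F) *v (x t - xs r) + r) \<longlongrightarrow> r) \<F>" by simp
    have "\<forall>\<^sub>F t in \<F>. (C + D ** F) *v (x t - xs r) + r = C *v x t + D *v u t"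
      using that(1) by (rule eventually_mono) (simp add: out_eq)
    with lim show ?thesis by (rule Lim_transform_eventually)
  qed
  show ?thesis
  proof (cases T)
    case Continuous
    have "((\<lambda>t. C *v x t + D *v u t) \<longlongrightarrow> r) at_top"
      if u: "\<forall>t\<ge>0. u t = F *v x t + G *v r"
        and x: "\<forall>t\<ge>0. (x has_vector_derivative A *v x t + B *v u t) (at t within {0..})" for r and x :: "real \<Rightarrow> real^'n" and u
    proof (rule limit)
      show "\<forall>\<^sub>F t in at_top. u t = F *v x t + G *v r"
        using u by (intro eventually_mono[OF eventually_ge_at_top[of 0]]) simp
      fix b assume b: "b \<in> S"
      show "((\<lambda>t. \<phi> b (x t - xs r)) \<longlongrightarrow> 0) at_top"
      proof (rule scalar_exponential_decay)
        show "l b < 0" using eig(2)[OF b] Continuous by (simp add: stable_reals_def)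
        fix t :: real assume t: "t \<ge> 0"
        have "A *v x t + B *v u t = ?M *v (x t - xs r)"
          using xs[of r] u t Continuous
          by (simp add: matrix_vector_mult_add_rdistrib matrix_vector_mul_assoc steady_frequency_def
              matrix_vector_mult_diff_distrib matrix_vector_right_distrib algebra_simps)
        then have "(x has_vector_derivative ?M *v (x t - xs r)) (at t within {0..})"
          using x t by metis
        then have "((\<lambda>t. x t - xs r) has_vector_derivative ?M *v (x t - xs r)) (at t within {0..})"
          by (auto intro!: derivative_eq_intros)
        from bounded_linear.has_vector_derivative[OF \<phi>(1)[of b] this]
        show "((\<lambda>t. \<phi> b (x t - xs r)) has_vector_derivative l b * \<phi> b (x t - xs r)) (at t within {0..})"
          by (simp only: \<phi>(3)[OF b])
      qed
    qed
    then show ?thesis unfolding Continuous tracks_constant_references.simps by blast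
  next
    case Discrete
    have "(\<lambda>t. C *v x t + D *v u t) \<longlonglongrightarrow> r"
      if u: "\<forall>t. u t = F *v x t + G *v r"
        and x: "\<forall>t. x (Suc t) = A *v x t + B *v u t" for r and x :: "nat \<Rightarrow> real^'n" and u
    proof (rule limit)
      show "\<forall>\<^sub>F t in sequentially. u t = F *v x t + G *v r"
        using u by simp
      fix b assume b: "b \<in> S"
      have step: "x (Suc t) - xs r = ?M *v (x t - xs r)" for t
        using xs[of r] u x Discrete
        by (simp add: matrix_vector_mult_add_rdistrib matrix_vector_mul_assoc steady_frequency_def
            matrix_vector_mult_diff_distrib matrix_vector_right_distrib algebra_simps)
      have "\<phi> b (x t - xs r) = l b ^ t * \<phi> b (x 0 - xs r)" for t
        by (induction t) (simp_all only: step \<phi>(3)[OF b], simp_all)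
      then have coord: "(\<lambda>t. \<phi> b (x t - xs r)) = (\<lambda>t. l b ^ t * \<phi> b (x 0 - xs r))"
        by (rule ext)
      have "\<bar>l b\<bar> < 1" using eig(2)[OF b] Discrete by (simp add: stable_reals_def)
      then have "(\<lambda>t. l b ^ t) \<longlonglongrightarrow> 0" by (intro LIMSEQ_power_zero) simp
      then show "(\<lambda>t. \<phi> b (x t - xs r)) \<longlonglongrightarrow> 0"
        unfolding coord by (rule tendsto_mult_left_zero)
    qed
    then show ?thesis unfolding Discrete tracks_constant_references.simps by blast
  qed
qed

subsection \<open>Modes observable from a single output\<close>

lemma drop_row_mult:
  fixes C :: "real^'n^'p" and x :: "real^'n" and y :: "complex^'n"
  shows "drop_row i C *v x = (\<chi> k. if k = i then 0 else (C *v x) $ k)"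
    "complex_matrix (drop_row i C) *v y = (\<chi> k. if k = i then 0 else (complex_matrix C *v y) $ k)"
  by (auto simp: vec_eq_iff drop_row_def matrix_vector_mult_def complex_matrix_def)

definition observable_modes ::
  "time_domain \<Rightarrow> real^'n^'n \<Rightarrow> real^'m^'n \<Rightarrow> real^'n^'p \<Rightarrow> real^'m^'p \<Rightarrow> 'p \<Rightarrow> (real^'n) set" where
  "observable_modes T A B C D i = {v. \<exists>l w c. l \<in> stable_reals T \<and> complex_of_real l \<notin> invariant_zeros A B C D \<and>
     c \<noteq> 0 \<and> A *v v + B *v w = l *\<^sub>R v \<and> C *v v + D *v w = c *\<^sub>R axis i 1}"

lemma observable_modesI:
  assumes "l \<in> stable_reals T" "complex_of_real l \<notin> invariant_zeros A B C D" "c \<noteq> 0"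
    and "A *v v + B *v w = l *\<^sub>R v" "C *v v + D *v w = c *\<^sub>R axis i 1"
  shows "v \<in> observable_modes T A B C D i"
  unfolding observable_modes_def using assms by blast

text \<open>Solutions for the full pencil, which is onto at l, also solve the problem with the
  dropped row whenever the target has zero output part; this is exactly what
  \<open>kernel_in_R\<close> asks for.\<close>

lemma observable_modes_le_R:
  assumes ri: "right_invertible A B C D"
  shows "observable_modes T A B C D i \<subseteq> R_star_output A B C D i"
proof
  fix v assume "v \<in> observable_modes T A B C D i"
  then obtain l w c where l: "complex_of_real l \<notin> invariant_zeros A B C D"
    and lw: "A *v v + B *v w = l *\<^sub>R v" "C *v v + D *v w = c *\<^sub>R axis i 1"
    by (auto simp: observable_modes_def)
  interpret Q: quadruple A B "drop_row i C" "drop_row i D" .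
  have "drop_row i C *v v + drop_row i D *v w = (\<chi> k. if k = i then 0 else (C *v v + D *v w) $ k)"
    by (simp add: drop_row_mult vec_eq_iff)
  also have "\<dots> = 0"
    unfolding lw(2) by (simp add: vec_eq_iff axis_def)
  finally have 0: "drop_row i C *v v + drop_row i D *v w = 0" .
  have "upper (stack (of_real_vec v) (of_real_vec w)) \<in> complexify Q.R"
  proof (rule Q.kernel_in_R[of "of_real l"])
    show "pencil A B (drop_row i C) (drop_row i D) (of_real l) *v stack (of_real_vec v) (of_real_vec w) = 0"
      unfolding pencil_mult_eq_0_iff using lw(1) 0 by (simp add: complex_vec_eq_iff)
    fix x
    obtain \<xi> where \<xi>: "pencil A B C D (of_real l) *v \<xi> = stack x 0"
      using pencil_surj[OF ri l] by blast
    then have "complex_matrix C *v upper \<xi> + complex_matrix D *v lower \<xi> = 0"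
      unfolding pencil_mult by (metis stack_simps(2))
    then have "complex_matrix (drop_row i C) *v upper \<xi> + complex_matrix (drop_row i D) *v lower \<xi> = 0"
      by (auto simp: drop_row_mult vec_eq_iff)
    then have "pencil A B (drop_row i C) (drop_row i D) (of_real l) *v \<xi> = stack x 0"
      using \<xi> unfolding pencil_mult by (metis stack_simps(1))
    then show "\<exists>\<xi>. pencil A B (drop_row i C) (drop_row i D) (of_real l) *v \<xi> = stack x 0" by blast
  qed
  then show "v \<in> R_star_output A B C D i"
    by (simp add: R_star_output_def Q.subspace_R)
qed

text \<open>Deleting the finitely many zeros leaves infinitely many stable eigenvalues, so the modes
  of the dropped-row system there still span.\<close>

lemma R_le_span_observable_modes:
  assumes ri: "right_invertible A B C D"
  shows "R_star_output A B C D i \<subseteq> span (observable_modes T A B C D i)"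
proof -
  interpret Q: quadruple A B "drop_row i C" "drop_row i D" .
  define \<Lambda> where "\<Lambda> = stable_reals T - complex_of_real -` invariant_zeros A B C D"
  have "finite (complex_of_real -` invariant_zeros A B C D)"
    by (rule finite_vimageI[OF finite_invariant_zeros[OF ri]]) (simp add: inj_on_def)
  then have "infinite \<Lambda>" unfolding \<Lambda>_def using infinite_stable_reals by (simp add: Diff_infinite_finite)
  then have "R_star_output A B C D i \<subseteq> span (Q.modes \<Lambda>)"
    unfolding R_star_output_def by (rule Q.R_le_span_modes)
  also have "\<dots> \<subseteq> span (observable_modes T A B C D i)"
  proof (rule span_minimal)
    show "Q.modes \<Lambda> \<subseteq> span (observable_modes T A B C D i)"
    proof
      fix v assume "v \<in> Q.modes \<Lambda>"
      then obtain l w where l: "l \<in> stable_reals T" "complex_of_real l \<notin> invariant_zeros A B C D"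
        and w: "A *v v + B *v w = l *\<^sub>R v" "drop_row i C *v v + drop_row i D *v w = 0"
        by (auto simp: Q.modes_def \<Lambda>_def)
      define c where "c = (C *v v + D *v w) $ i"
      have "(C *v v + D *v w) $ k = 0" if "k \<noteq> i" for k
        using w(2) that by (auto simp: drop_row_mult vec_eq_iff dest!: spec[of _ k])
      then have c: "C *v v + D *v w = c *\<^sub>R axis i 1"
        by (auto simp: c_def vec_eq_iff axis_def)
      show "v \<in> span (observable_modes T A B C D i)"
      proof (cases "c = 0")
        case False
        then have "v \<in> observable_modes T A B C D i"
          using l w(1) c by (intro observable_modesI)
        then show ?thesis by (rule span_base)
      next
        \<comment> \<open>Here \<open>v\<close> is invisible at every output. The pencil is onto at
          l, so some \<open>v'\<close> has output exactly the i-th unit vector; \<open>v'\<close>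
          and \<open>v + v'\<close> are both observable and differ by \<open>v\<close>.\<close>
        case True
        obtain v' w' where v': "A *v v' + B *v w' = l *\<^sub>R v'" "C *v v' + D *v w' = axis i 1"
          using pencil_real_surj[OF ri l(2), of 0 "axis i 1"] by auto
        have "v' \<in> observable_modes T A B C D i"
          using l v' by (intro observable_modesI[of l T A B C D 1]) auto
        moreover have "v + v' \<in> observable_modes T A B C D i"
        proof -
          have "A *v (v + v') + B *v (w + w') = (A *v v + B *v w) + (A *v v' + B *v w')"
            "C *v (v + v') + D *v (w + w') = (C *v v + D *v w) + (C *v v' + D *v w')"
            by (simp_all add: matrix_vector_right_distrib)
          then have "A *v (v + v') + B *v (w + w') = l *\<^sub>R (v + v')" "C *v (v + v') + D *v (w + w') = 1 *\<^sub>R axis i 1"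
            using w(1) v' c True by (simp_all add: scaleR_add_right)
          then show ?thesis by (rule observable_modesI[OF l one_neq_zero])
        qed
        ultimately have "(v + v') - v' \<in> span (observable_modes T A B C D i)"
          by (intro span_diff span_base)
        then show ?thesis by simp
      qed
    qed
  qed simp
  finally show ?thesis .
qed

lemma sum_subspaces_eq_span:
  fixes S :: "'k \<Rightarrow> 'a::real_vector set"
  assumes "finite P" "\<And>i. i \<in> P \<Longrightarrow> subspace (S i)"
  shows "(\<Sum>i\<in>P. S i) = span (\<Union>i\<in>P. S i)"
  using assms
proof (induction P rule: finite_induct)
  case (insert i P)
  have "S i = span (S i)" using insert.prems by (simp add: span_eq_iff[THEN iffD2])
  then have "(\<Sum>i\<in>insert i P. S i) = span (S i) + span (\<Union>i\<in>P. S i)"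
    using insert by simp
  also have "\<dots> = span (S i \<union> (\<Union>i\<in>P. S i))"
    by (auto simp: span_Un set_plus_def)
  finally show ?case by simp
qed (simp add: set_zero)

lemma plus_span: "span S + span T = span (S \<union> T)" for S T :: "'a::real_vector set"
  by (auto simp: span_Un set_plus_def)

subsection \<open>Solvability\<close>

definition modes_in :: "nat \<Rightarrow> ('p \<Rightarrow> nat) \<Rightarrow> 'p option set \<Rightarrow> ('p option \<times> nat) set" where
  "modes_in \<nu>\<^sub>0 \<nu> Q = (SIGMA k:Q. {..<(case k of None \<Rightarrow> \<nu>\<^sub>0 | Some i \<Rightarrow> \<nu> i)})"

lemma card_modes_in:
  fixes P :: "'p::finite set"
  shows "card (modes_in \<nu>\<^sub>0 \<nu> (Some ` P)) = (\<Sum>i\<in>P. \<nu> i)"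
    "card (modes_in \<nu>\<^sub>0 \<nu> (insert None (Some ` P))) = (\<Sum>i\<in>P. \<nu> i) + \<nu>\<^sub>0"
  by (simp_all add: modes_in_def card_SigmaI sum.reindex)

lemma mode_indices_eq: "mode_indices \<nu>\<^sub>0 \<nu> = modes_in \<nu>\<^sub>0 \<nu> (insert None (Some ` UNIV))"
  by (simp add: mode_indices_def modes_in_def UNIV_option_conv)

lemma finite_modes_in: "finite (modes_in \<nu>\<^sub>0 \<nu> Q)" for Q :: "'p::finite option set"
  by (simp add: modes_in_def)

lemma subspace_R_star_output: "subspace (R_star_output A B C D i)"
  by (simp add: R_star_output_def quadruple.subspace_R)

text \<open>A count: the modes of the outputs in P, with or without the unobservable ones, are
  independent vectors of the subspace in question.\<close>

lemma dimension_bounds_if_solvable: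
  fixes A :: "real^'n^'n" and B :: "real^'m^'n" and C :: "real^'n^'p" and D :: "real^'m^'p"
  assumes ri: "right_invertible A B C D"
    and Vg: "V_star_g T A B C D = span (quadruple.modes A B C D (stable_reals T))"
    and solvable: "problem_1C_solvable T A B C D \<nu>\<^sub>0 \<nu>"
  shows "(\<Sum>i\<in>P. \<nu> i) + \<nu>\<^sub>0 \<le> dim (V_star_g T A B C D + (\<Sum>i\<in>P. R_star_output A B C D i))"
    and "(\<Sum>i\<in>P. \<nu> i) \<le> dim (\<Sum>i\<in>P. R_star_output A B C D i)"
proof -
  obtain F :: "real^'n^'m" and lam v where spec: "spectrum (A + B ** F) \<subseteq> stability_region T"
    and dec: "decoupling_modes A B C D F \<nu>\<^sub>0 \<nu> lam v"
    and nz: "\<And>i j. j < \<nu> i \<Longrightarrow> complex_of_real (lam (Some i, j)) \<notin> invariant_zeros A B C D"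
    using solvable by (auto simp: problem_1C_solvable_def)
  let ?K = "mode_indices \<nu>\<^sub>0 \<nu>"
  have inj: "inj_on v ?K" and ind: "independent (v ` ?K)"
    and eig: "\<And>k. k \<in> ?K \<Longrightarrow> A *v v k + B *v (F *v v k) = lam k *\<^sub>R v k"
    and out0: "\<And>j. j < \<nu>\<^sub>0 \<Longrightarrow> C *v v (None, j) + D *v (F *v v (None, j)) = 0"
    and out: "\<And>i j. j < \<nu> i \<Longrightarrow> \<exists>c. c \<noteq> 0 \<and> C *v v (Some i, j) + D *v (F *v v (Some i, j)) = c *\<^sub>R axis i 1"
    using dec[unfolded decoupling_modes_def closed_loop_mult] by blast+
  have stable: "lam k \<in> stable_reals T" if "k \<in> ?K" for k
  proof -
    have "v k \<noteq> 0" using ind that by (metis dependent_zero imageI)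
    moreover have "(A + B ** F) *v v k = lam k *\<^sub>R v k"
      using eig[OF that] by (simp add: closed_loop_mult)
    ultimately show ?thesis
      using real_eigenvalue_in_spectrum spec by (fastforce simp: stable_reals_def)
  qed
  have R: "v (Some i, j) \<in> R_star_output A B C D i" if "j < \<nu> i" for i j
  proof -
    have K: "(Some i, j) \<in> ?K" using that by (simp add: mode_indices_def)
    obtain c where "c \<noteq> 0" "C *v v (Some i, j) + D *v (F *v v (Some i, j)) = c *\<^sub>R axis i 1"
      using out[OF \<open>j < \<nu> i\<close>] by blast
    then have "v (Some i, j) \<in> observable_modes T A B C D i"
      by (intro observable_modesI[OF stable[OF K] nz[OF that] _ eig[OF K]])
    then show ?thesis using observable_modes_le_R[OF ri] by blast
  qed
  have V: "v (None, j) \<in> V_star_g T A B C D" if "j < \<nu>\<^sub>0" for j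
  proof -
    have K: "(None, j) \<in> ?K" using that by (simp add: mode_indices_def)
    then have "v (None, j) \<in> quadruple.modes A B C D (stable_reals T)"
      unfolding quadruple.modes_def using eig[OF K] stable[OF K] out0[OF that] by blast
    then show ?thesis unfolding Vg by (rule span_base)
  qed
  have sumR: "(\<Sum>i\<in>P. R_star_output A B C D i) = span (\<Union>i\<in>P. R_star_output A B C D i)"
    by (rule sum_subspaces_eq_span) (auto intro: subspace_R_star_output)
  have card_le: "card (modes_in \<nu>\<^sub>0 \<nu> Q) \<le> dim W" if "v ` modes_in \<nu>\<^sub>0 \<nu> Q \<subseteq> W" for Q W
  proof -
    have sub: "modes_in \<nu>\<^sub>0 \<nu> Q \<subseteq> ?K" by (auto simp: modes_in_def mode_indices_def)
    have "card (v ` modes_in \<nu>\<^sub>0 \<nu> Q) \<le> dim W"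
      using that independent_mono[OF ind image_mono[OF sub]] by (rule independent_card_le_dim)
    then show ?thesis using card_image inj inj_on_subset sub by metis
  qed
  show "(\<Sum>i\<in>P. \<nu> i) \<le> dim (\<Sum>i\<in>P. R_star_output A B C D i)"
    unfolding card_modes_in(1)[of \<nu>\<^sub>0 \<nu> P, symmetric]
    by (rule card_le) (auto simp: modes_in_def sumR intro!: span_base R)
  have "V_star_g T A B C D + (\<Sum>i\<in>P. R_star_output A B C D i) =
      span (V_star_g T A B C D \<union> (\<Union>i\<in>P. R_star_output A B C D i))"
    unfolding sumR by (simp only: Vg plus_span[symmetric] span_span)
  then show "(\<Sum>i\<in>P. \<nu> i) + \<nu>\<^sub>0 \<le> dim (V_star_g T A B C D + (\<Sum>i\<in>P. R_star_output A B C D i))"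
    unfolding card_modes_in(2)[symmetric]
    by (simp only:) (rule card_le, auto simp: modes_in_def intro!: span_base R V)
qed

text \<open>The transversal has as many vectors as the state dimension, hence is an eigenbasis, and
  one feedback realises all its inputs at once.\<close>

lemma solvable_if_dimension_bounds:
  fixes A :: "real^'n^'n" and B :: "real^'m^'n" and C :: "real^'n^'p" and D :: "real^'m^'p"
  assumes ri: "right_invertible A B C D"
    and nz: "steady_state_frequency T \<notin> invariant_zeros A B C D"
    and Vg: "V_star_g T A B C D = span (quadruple.modes A B C D (stable_reals T))"
    and n: "(\<Sum>i\<in>UNIV. \<nu> i) + \<nu>\<^sub>0 = CARD('n)"
    and dimV: "\<And>P :: 'p set. (\<Sum>i\<in>P. \<nu> i) + \<nu>\<^sub>0 \<le> dim (V_star_g T A B C D + (\<Sum>i\<in>P. R_star_output A B C D i))"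
    and dimR: "\<And>P :: 'p set. (\<Sum>i\<in>P. \<nu> i) \<le> dim (\<Sum>i\<in>P. R_star_output A B C D i)"
  shows "problem_1C_solvable T A B C D \<nu>\<^sub>0 \<nu>"
proof -
  let ?K = "mode_indices \<nu>\<^sub>0 \<nu>"
  define S where "S k = (case fst k of None \<Rightarrow> quadruple.modes A B C D (stable_reals T)
      | Some i \<Rightarrow> observable_modes T A B C D i)" for k :: "'p option \<times> nat"
  have finK: "finite ?K" unfolding mode_indices_eq by (rule finite_modes_in)
  have sumR: "(\<Sum>i\<in>P. R_star_output A B C D i) = span (\<Union>i\<in>P. R_star_output A B C D i)" for P
    by (rule sum_subspaces_eq_span) (auto intro: subspace_R_star_output)
  have "card J \<le> dim (\<Union>k\<in>J. S k)" if J: "J \<subseteq> ?K" for J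
  proof -
    \<comment> \<open>The outputs that \<open>J\<close> meets. Enlarging \<open>J\<close> to all
      modes of these outputs leaves the union of the sets unchanged, so the bound for the full block
      covers \<open>J\<close>.\<close>
    define P where "P = {i. Some i \<in> fst ` J}"
    have R: "(\<Union>i\<in>P. R_star_output A B C D i) \<subseteq> span (\<Union>k\<in>J. S k)"
    proof
      fix x assume "x \<in> (\<Union>i\<in>P. R_star_output A B C D i)"
      then obtain i j where "(Some i, j) \<in> J" "x \<in> R_star_output A B C D i" by (auto simp: P_def)
      moreover from this have "observable_modes T A B C D i \<subseteq> (\<Union>k\<in>J. S k)"
        by (auto simp: S_def intro!: bexI[of _ "(Some i, j)"])
      ultimately show "x \<in> span (\<Union>k\<in>J. S k)"
        using R_le_span_observable_modes[OF ri] span_mono by blast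
    qed
    show ?thesis
    proof (cases "None \<in> fst ` J")
      case True
      then obtain j where "(None, j) \<in> J" by auto
      then have "quadruple.modes A B C D (stable_reals T) \<subseteq> (\<Union>k\<in>J. S k)"
        by (auto simp: S_def intro!: bexI[of _ "(None, j)"])
      then have "V_star_g T A B C D \<subseteq> span (\<Union>k\<in>J. S k)"
        unfolding Vg by (rule span_mono)
      then have "span (V_star_g T A B C D \<union> (\<Union>i\<in>P. R_star_output A B C D i)) \<subseteq> span (\<Union>k\<in>J. S k)"
        using R by (intro span_minimal) auto
      moreover have "V_star_g T A B C D + (\<Sum>i\<in>P. R_star_output A B C D i) =
          span (V_star_g T A B C D \<union> (\<Union>i\<in>P. R_star_output A B C D i))"
        unfolding sumR by (simp only: Vg plus_span[symmetric] span_span)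
      ultimately have "dim (V_star_g T A B C D + (\<Sum>i\<in>P. R_star_output A B C D i)) \<le> dim (\<Union>k\<in>J. S k)"
        by (metis dim_span dim_subset)
      moreover have "J \<subseteq> modes_in \<nu>\<^sub>0 \<nu> (insert None (Some ` P))"
      proof
        fix k assume k: "k \<in> J"
        then have "fst k \<in> insert None (Some ` P)"
          by (cases "fst k") (auto simp: P_def image_iff intro: bexI[of _ k])
        then show "k \<in> modes_in \<nu>\<^sub>0 \<nu> (insert None (Some ` P))"
          using k J by (cases k) (auto simp: modes_in_def mode_indices_def)
      qed
      then have "card J \<le> (\<Sum>i\<in>P. \<nu> i) + \<nu>\<^sub>0"
        using card_mono[OF finite_modes_in] card_modes_in(2) by metis
      ultimately show ?thesis using dimV[of P] by linarith
    next
      case False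
      have "(\<Sum>i\<in>P. R_star_output A B C D i) \<subseteq> span (\<Union>k\<in>J. S k)"
        unfolding sumR using R by (intro span_minimal) auto
      then have "dim (\<Sum>i\<in>P. R_star_output A B C D i) \<le> dim (\<Union>k\<in>J. S k)"
        by (metis dim_span dim_subset)
      moreover have "J \<subseteq> modes_in \<nu>\<^sub>0 \<nu> (Some ` P)"
      proof
        fix k assume k: "k \<in> J"
        then have "fst k \<noteq> None" using False by (metis imageI)
        then have "fst k \<in> Some ` P"
          using k by (cases "fst k") (auto simp: P_def image_iff intro: bexI[of _ k])
        then show "k \<in> modes_in \<nu>\<^sub>0 \<nu> (Some ` P)"
          using k J by (cases k) (auto simp: modes_in_def mode_indices_def)
      qed
      then have "card J \<le> (\<Sum>i\<in>P. \<nu> i)"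
        using card_mono[OF finite_modes_in] card_modes_in(1) by metis
      ultimately show ?thesis using dimR[of P] by linarith
    qed
  qed
  then obtain v where v: "\<And>k. k \<in> ?K \<Longrightarrow> v k \<in> S k" and inj: "inj_on v ?K" and ind: "independent (v ` ?K)"
    using independent_transversal[OF finK] by metis
  have "card (v ` ?K) = CARD('n)"
    using card_image[OF inj] card_modes_in(2)[of \<nu>\<^sub>0 \<nu> UNIV] n by (simp add: mode_indices_eq)
  then have span: "span (v ` ?K) = UNIV"
    using card_ge_dim_independent[OF subset_UNIV ind] by auto
  define mode where "mode k l w \<longleftrightarrow> l \<in> stable_reals T \<and> A *v v k + B *v w = l *\<^sub>R v k \<and>
      (case fst k of None \<Rightarrow> C *v v k + D *v w = 0
       | Some i \<Rightarrow> complex_of_real l \<notin> invariant_zeros A B C D \<and> (\<exists>c. c \<noteq> 0 \<and> C *v v k + D *v w = c *\<^sub>R axis i 1))"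
    for k l w
  have "\<exists>l w. mode k l w"
    if "k \<in> ?K" for k
  proof (cases "fst k")
    case None
    then have "v k \<in> quadruple.modes A B C D (stable_reals T)"
      using v[OF that] by (simp add: S_def)
    then show ?thesis
      unfolding mode_def None option.case quadruple.modes_def by blast
  next
    case (Some i)
    then have "v k \<in> observable_modes T A B C D i"
      using v[OF that] by (simp add: S_def)
    then show ?thesis
      unfolding mode_def Some option.case observable_modes_def by blast
  qed
  then obtain lam w where mode: "\<And>k. k \<in> ?K \<Longrightarrow> mode k (lam k) (w k)" by metis
  have lw: "lam k \<in> stable_reals T" "A *v v k + B *v w k = lam k *\<^sub>R v k"
    "case fst k of None \<Rightarrow> C *v v k + D *v w k = 0
       | Some i \<Rightarrow> complex_of_real (lam k) \<notin> invariant_zeros A B C D \<and> (\<exists>c. c \<noteq> 0 \<and> C *v v k + D *v w k = c *\<^sub>R axis i 1)"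
    if "k \<in> ?K" for k
    using mode[OF that] by (simp_all only: mode_def)
  \<comment> \<open>The feedback is prescribed on vectors, the inputs \<open>w\<close> are indexed
    by modes; injectivity of \<open>v\<close> allows the passage.\<close>
  obtain F :: "real^'n^'m" where F: "\<And>b. b \<in> v ` ?K \<Longrightarrow> F *v b = w (inv_into ?K v b)"
    using feedback_exists[OF ind, of "\<lambda>b. w (inv_into ?K v b)"] by blast
  have Fv: "F *v v k = w k" if "k \<in> ?K" for k
    using F[of "v k"] inv_into_f_f[OF inj that] that by simp
  have eig: "(A + B ** F) *v v k = lam k *\<^sub>R v k" if "k \<in> ?K" for k
    using lw(2)[OF that] Fv[OF that] by (simp add: closed_loop_mult)
  have "spectrum_on (A + B ** F) (span (v ` ?K)) \<subseteq> stability_region T"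
    using eig lw(1) by (intro spectrum_on_eigenvectors) (fastforce simp: stable_reals_def)
  then have spec: "spectrum (A + B ** F) \<subseteq> stability_region T" by (simp add: span)
  obtain G :: "real^'p^'m" where G: "static_gain T A B C D F ** G = mat 1"
    using static_gain_right_inverse[OF ri nz spec] by blast
  have "tracks_constant_references T A B C D F G"
  proof (rule tracks_constant_references_if_eigenbasis[OF ind span _ _ G])
    fix b assume "b \<in> v ` ?K"
    then obtain k where k: "k \<in> ?K" "b = v k" by blast
    then have "inv_into ?K v b = k" using inv_into_f_f[OF inj] by simp
    then show "(A + B ** F) *v b = lam (inv_into ?K v b) *\<^sub>R b" "lam (inv_into ?K v b) \<in> stable_reals T"
      using eig lw(1) k by simp_all
  qed
  moreover have "decoupling_modes A B C D F \<nu>\<^sub>0 \<nu> lam v"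
    unfolding decoupling_modes_def
  proof (intro conjI ballI allI impI inj ind span eig)
    fix j assume "j < \<nu>\<^sub>0"
    then have K: "(None, j) \<in> ?K" by (simp add: mode_indices_def)
    show "(C + D ** F) *v v (None, j) = 0"
      using lw(3)[OF K] Fv[OF K] by (simp add: closed_loop_mult)
  next
    fix i j assume "j < \<nu> i"
    then have K: "(Some i, j) \<in> ?K" by (simp add: mode_indices_def)
    show "\<exists>c. c \<noteq> 0 \<and> (C + D ** F) *v v (Some i, j) = c *\<^sub>R axis i 1"
      using lw(3)[OF K] Fv[OF K] by (simp add: closed_loop_mult)
  qed
  moreover have "complex_of_real (lam (Some i, j)) \<notin> invariant_zeros A B C D" if "j < \<nu> i" for i j
    using lw(3)[of "(Some i, j)"] that by (simp add: mode_indices_def)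
  ultimately show ?thesis
    unfolding problem_1C_solvable_def using spec G by blast
qed

theorem theorem12:
  fixes T :: time_domain
    and A :: "real^'n^'n" and B :: "real^'m^'n" and C :: "real^'n^'p" and D :: "real^'m^'p"
    and \<nu>\<^sub>0 :: nat and \<nu> :: "'p \<Rightarrow> nat"
  assumes "right_invertible A B C D"
    and "stabilizable T A B"
    and "steady_state_frequency T \<notin> invariant_zeros A B C D"
    and "\<And>z. z \<in> minimum_phase_zeros T A B C D \<Longrightarrow>
           zero_algebraic_multiplicity A B C D z = zero_geometric_multiplicity A B C D z"
    and "minimum_phase_zeros T A B C D \<subseteq> \<real>"
    and "(\<Sum>i\<in>UNIV. \<nu> i) \<le> CARD('n)"
    and "\<nu>\<^sub>0 = CARD('n) - (\<Sum>i\<in>UNIV. \<nu> i)"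
  shows "problem_1C_solvable T A B C D \<nu>\<^sub>0 \<nu> \<longleftrightarrow>
    (\<forall>P :: 'p set.
       dim (V_star_g T A B C D + (\<Sum>i\<in>P. R_star_output A B C D i)) \<ge> (\<Sum>i\<in>P. \<nu> i) + \<nu>\<^sub>0 \<and>
       dim (\<Sum>i\<in>P. R_star_output A B C D i) \<ge> (\<Sum>i\<in>P. \<nu> i))"
proof -
  have Vg: "V_star_g T A B C D = span (quadruple.modes A B C D (stable_reals T))"
    by (rule quadruple.V_star_g_eq_span_modes[OF assms(1,4,5)])
  show ?thesis
  proof (intro iffI allI conjI)
    fix P assume "problem_1C_solvable T A B C D \<nu>\<^sub>0 \<nu>"
    from dimension_bounds_if_solvable[OF assms(1) Vg this]
    show "(\<Sum>i\<in>P. \<nu> i) + \<nu>\<^sub>0 \<le> dim (V_star_g T A B C D + (\<Sum>i\<in>P. R_star_output A B C D i))"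
      "(\<Sum>i\<in>P. \<nu> i) \<le> dim (\<Sum>i\<in>P. R_star_output A B C D i)" .
  next
    have "(\<Sum>i\<in>UNIV. \<nu> i) + \<nu>\<^sub>0 = CARD('n)" using assms(6,7) by simp
    from solvable_if_dimension_bounds[OF assms(1,3) Vg this]
    show "problem_1C_solvable T A B C D \<nu>\<^sub>0 \<nu>"
      if "\<forall>P :: 'p set. (\<Sum>i\<in>P. \<nu> i) + \<nu>\<^sub>0 \<le> dim (V_star_g T A B C D + (\<Sum>i\<in>P. R_star_output A B C D i)) \<and>
         (\<Sum>i\<in>P. \<nu> i) \<le> dim (\<Sum>i\<in>P. R_star_output A B C D i)"
      using that by blast
  qed
qed

end
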